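(* $\mathrm{QSym}$ is rigid as a Hopf algebra with respect to the quasisymmetric Schur basis: if $\varphi:\mathrm{QSym}\to\mathrm{QSym}$ is a graded Hopf algebra automorphism with $\varphi(\{\mathcal{S}_\alpha:\alpha\in\mathcal{C}\})=\{\mathcal{S}_\alpha:\alpha\in\mathcal{C}\}$, then $\varphi$ is the identity map.
   Context: A composition is a finite (possibly empty) ordered list $\alpha=(\alpha_1,\dots,\alpha_k)$ of positive integers; $|\alpha|=\alpha_1+\cdots+\alpha_k$, and $\mathcal{C}$ is the set of all compositions ($\emptyset$ is the empty one). $\mathrm{QSym}$ is the set of bounded-degree formal power series $f\in\mathbb{Q}[[x_1,x_2,\dots]]$ such that for each composition $(\alpha_1,\dots,\alpha_k)$ all monomials $x_{i_1}^{\alpha_1}\cdots x_{i_k}^{\alpha_k}$ with $i_1<\cdots<i_k$ have the same coefficient in $f$. Let $M_\emptyset=1$ and $M_\alpha=\sum_{i_1<\cdots<i_k}x_{i_1}^{\alpha_1}\cdots x_{i_k}^{\alpha_k}$. $\mathrm{QSym}=\bigoplus_{n\ge0}\mathrm{QSym}_n$ is a connected graded Hopf algebra over $\mathbb{Q}$ with $\mathrm{QSym}_n=\mathrm{span}\{M_\alpha:|\alpha|=n\}$, the product of power series, coproduct $\Delta(M_\alpha)=\sum_{\alpha=\beta\cdot\gamma}M_\beta\otimes M_\gamma$ (all deconcatenations, empty compositions allowed), and counit $\varepsilon(M_\emptyset)=1$, $\varepsilon(M_\alpha)=0$ for $\alpha\neq\emptyset$. A map is graded if it maps $\mathrm{QSym}_n$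 into $\mathrm{QSym}_n$ for all $n$. Quasisymmetric Schur functions: the reverse composition diagram of $\alpha=(\alpha_1,\dots,\alpha_k)$ is the left-justified array with $\alpha_i$ cells in row $i$ (rows numbered from top to bottom, columns from left to right); $(i,j)$ denotes the cell in row $i$, column $j$. A semistandard reverse composition tableau (SSRCT) of shape $\alpha$ is a filling $\tau$ of the cells of $\alpha$ with positive integers such that (1) entries in each row weakly decrease from left to right; (2) entries in the first column strictly increase from top to bottom; (3) if $i<j$, $(i,k),(j,k+1)\in\alpha$ and $\tau(i,k)\ge\tau(j,k+1)$, then $(i,k+1)\in\alpha$ and $\tau(i,k+1)>\tau(j,k+1)$. Put $x^\tau=\prod_i x_i^{c_i}$ with $c_i$ the number of entries of $\tau$ equal to $i$. Then $\mathcal{S}_\emptyset=1$ and $\mathcal{S}_\alpha=\sum_\tau x^\tau$, sum over all SSRCTs of shape $\alpha$. It is known that $\{\mathcal{S}_\alpha:\alpha\in\mathcal{C}\}$ is a basis of $\mathrm{QSym}$, with $\mathcal{S}_\alpha\in\mathrm{QSym}_{|\alpha|}$. *)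

theory Defs
  imports Complex_Main "HOL-Library.Poly_Mapping" "HOL-Library.FuncSet"
begin

section \<open>Compositions\<close>

typedef composition = "{xs :: nat list. 0 \<notin> set xs}"
  morphisms parts Abs_composition
  by (rule exI[of _ "[]"]) simp

setup_lifting type_definition_composition

lift_definition empty_comp :: composition is "[]" by simp

lift_definition concat_comp :: "composition \<Rightarrow> composition \<Rightarrow> composition" is "(@)" by simp

definition csize :: "composition \<Rightarrow> nat" where
  "csize \<alpha> = sum_list (parts \<alpha>)"

lemma parts_nonzero: "0 \<notin> set (parts \<alpha>)"
  using parts by simp

lemma finite_csize_le: "finite {\<alpha>. csize \<alpha> \<le> d}"
proof -
  have len: "length xs \<le> sum_list xs" if "0 \<notin> set xs" for xs :: "nat list"
    using that by (induction xs) auto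
  have "parts ` {\<alpha>. csize \<alpha> \<le> d} \<subseteq> {xs. set xs \<subseteq> {..d} \<and> length xs \<le> d}"
  proof (clarsimp simp: csize_def, intro conjI subsetI)
    fix \<alpha> x assume s: "sum_list (parts \<alpha>) \<le> d"
    show "length (parts \<alpha>) \<le> d" using len[OF parts_nonzero[of \<alpha>]] s by linarith
    assume "x \<in> set (parts \<alpha>)"
    with s show "x \<in> {..d}" using member_le_sum_list[of x "parts \<alpha>"] by simp
  qed
  moreover have "finite {xs. set xs \<subseteq> {..d} \<and> length xs \<le> d}"
    by (rule finite_lists_length_le) simp
  ultimately show ?thesis
    by (meson finite_subset finite_imageD inj_onI parts_inject)
qed

definition deconcatenations :: "composition \<Rightarrow> (composition \<times> composition) set" where
  "deconcatenations \<alpha> = {(\<beta>, \<gamma>). \<alpha> = concat_comp \<beta> \<gamma>}"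

lemma finite_deconcatenations: "finite (deconcatenations \<alpha>)"
proof (rule finite_subset)
  show "deconcatenations \<alpha> \<subseteq> {\<beta>. csize \<beta> \<le> csize \<alpha>} \<times> {\<gamma>. csize \<gamma> \<le> csize \<alpha>}"
    by (auto simp: deconcatenations_def csize_def concat_comp.rep_eq)
  show "finite ({\<beta>. csize \<beta> \<le> csize \<alpha>} \<times> {\<gamma>. csize \<gamma> \<le> csize \<alpha>})"
    by (intro finite_cartesian_product finite_csize_le)
qed


section \<open>Monomials and formal power series\<close>

text \<open>A monomial is its exponent vector, written additively; the key \<open>i\<close> stands for the
  variable $x_{i+1}$.  A formal power series is its coefficient function on monomials.\<close>

type_synonym monomial = "nat \<Rightarrow>\<^sub>0 nat"

definition mdegree :: "monomial \<Rightarrow> nat" where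
  "mdegree m = (\<Sum>i\<in>Poly_Mapping.keys m. Poly_Mapping.lookup m i)"

definition mono_of :: "nat list \<Rightarrow> nat list \<Rightarrow> monomial" where
  "mono_of is es = sum_list (map2 Poly_Mapping.single is es)"

definition bounded_degree :: "(monomial \<Rightarrow> rat) \<Rightarrow> bool" where
  "bounded_degree f \<longleftrightarrow> (\<exists>d. \<forall>m. f m \<noteq> 0 \<longrightarrow> mdegree m \<le> d)"

definition quasisymmetric :: "(monomial \<Rightarrow> rat) \<Rightarrow> bool" where
  "quasisymmetric f \<longleftrightarrow>
     (\<forall>\<alpha> is js. sorted_wrt (<) is \<and> sorted_wrt (<) js
        \<and> length is = length (parts \<alpha>) \<and> length js = length (parts \<alpha>)
        \<longrightarrow> f (mono_of is (parts \<alpha>)) = f (mono_of js (parts \<alpha>)))"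

text \<open>Convolution; the index set is finite by \<open>finite_antidiag\<close>.\<close>

definition series_times :: "(monomial \<Rightarrow> rat) \<Rightarrow> (monomial \<Rightarrow> rat) \<Rightarrow> monomial \<Rightarrow> rat" where
  "series_times f g m = (\<Sum>(a, b)\<in>{(a, b). a + b = m}. f a * g b)"

lemma keys_add_nat:
  fixes a b :: monomial
  shows "Poly_Mapping.keys (a + b) = Poly_Mapping.keys a \<union> Poly_Mapping.keys b"
  by (auto simp: in_keys_iff lookup_add)

lemma mdegree_superset:
  assumes "finite A" "Poly_Mapping.keys m \<subseteq> A"
  shows "mdegree m = (\<Sum>i\<in>A. Poly_Mapping.lookup m i)"
  unfolding mdegree_def using assms
  by (intro sum.mono_neutral_left) (auto simp: in_keys_iff)

lemma mdegree_add: "mdegree (a + b) = mdegree a + mdegree b"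
proof -
  let ?A = "Poly_Mapping.keys a \<union> Poly_Mapping.keys b"
  have "mdegree a = (\<Sum>i\<in>?A. Poly_Mapping.lookup a i)"
    "mdegree b = (\<Sum>i\<in>?A. Poly_Mapping.lookup b i)"
    "mdegree (a + b) = (\<Sum>i\<in>?A. Poly_Mapping.lookup (a + b) i)"
    by (rule mdegree_superset; simp add: keys_add_nat)+
  then show ?thesis by (simp add: lookup_add sum.distrib)
qed

lemma mdegree_zero [simp]: "mdegree 0 = 0"
  by (simp add: mdegree_def)

lemma mdegree_single [simp]: "mdegree (Poly_Mapping.single i n) = n"
  by (simp add: mdegree_def)

lemma mdegree_sum: "mdegree (\<Sum>x\<in>A. h x) = (\<Sum>x\<in>A. mdegree (h x))"
  by (induction A rule: infinite_finite_induct) (auto simp: mdegree_add)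

lemma finite_antidiag: "finite {(a, b). a + b = (m :: monomial)}"
proof -
  let ?A = "{(a, b). a + b = m}"
  let ?h = "\<lambda>(a, b :: monomial). restrict (Poly_Mapping.lookup a) (Poly_Mapping.keys m)"
  have "?h ` ?A \<subseteq> PiE (Poly_Mapping.keys m) (\<lambda>k. {..Poly_Mapping.lookup m k})"
    by (auto simp: lookup_add)
  moreover have "finite (PiE (Poly_Mapping.keys m) (\<lambda>k. {..Poly_Mapping.lookup m k}))"
    by (intro finite_PiE) auto
  moreover have "inj_on ?h ?A"
  proof (rule inj_onI, clarsimp)
    fix a b c d :: monomial
    assume eq: "c + d = a + b" 
      and r: "restrict (Poly_Mapping.lookup a) (Poly_Mapping.keys (a + b)) 
            = restrict (Poly_Mapping.lookup c) (Poly_Mapping.keys (a + b))"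
    have "a = c"
    proof (rule poly_mapping_eqI)
      fix k show "Poly_Mapping.lookup a k = Poly_Mapping.lookup c k"
      proof (cases "k \<in> Poly_Mapping.keys (a + b)")
        case True then show ?thesis using fun_cong[OF r, of k] by simp
      next
        case False
        moreover from False have "k \<notin> Poly_Mapping.keys (c + d)" using eq by simp
        ultimately show ?thesis by (simp add: keys_add_nat in_keys_iff)
      qed
    qed
    then show "a = c \<and> b = d" using eq by simp
  qed
  ultimately show ?thesis by (meson finite_subset finite_imageD)
qed

subsection \<open>Order-preserving relabelling of variables\<close>

definition relabel :: "(nat \<Rightarrow> nat) \<Rightarrow> monomial \<Rightarrow> monomial" where
  "relabel s m = (\<Sum>i\<in>Poly_Mapping.keys m. Poly_Mapping.single (s i) (Poly_Mapping.lookup m i))"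

lemma relabel_zero [simp]: "relabel s 0 = 0"
  by (simp add: relabel_def)

lemma relabel_single [simp]: "relabel s (Poly_Mapping.single i n) = Poly_Mapping.single (s i) n"
  by (cases "n = 0") (auto simp: relabel_def)

lemma relabel_add: "relabel s (a + b) = relabel s a + relabel s b"
  unfolding relabel_def by (rule setsum_keys_plus_distrib) (auto simp: single_add)

lemma relabel_sum: "relabel s (\<Sum>x\<in>A. h x) = (\<Sum>x\<in>A. relabel s (h x))"
  by (induction A rule: infinite_finite_induct) (auto simp: relabel_add)

lemma monomial_expand:
  fixes m :: monomial
  shows "m = (\<Sum>i\<in>Poly_Mapping.keys m. Poly_Mapping.single i (Poly_Mapping.lookup m i))"
proof (rule poly_mapping_eqI)
  fix k
  show "Poly_Mapping.lookup m k = Poly_Mapping.lookup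
     (\<Sum>i\<in>Poly_Mapping.keys m. Poly_Mapping.single i (Poly_Mapping.lookup m i)) k"
    by (simp add: lookup_sum lookup_single when_def in_keys_iff)
qed

lemma relabel_relabel: "relabel t (relabel s m) = relabel (t \<circ> s) m"
  unfolding relabel_def[of s] relabel_sum by (simp add: relabel_def[of "t \<circ> s"])

lemma relabel_id:
  assumes "\<And>i. i \<in> Poly_Mapping.keys m \<Longrightarrow> s i = i"
  shows "relabel s m = m"
  by (subst (3) monomial_expand) (use assms in \<open>simp add: relabel_def\<close>)

lemma relabel_cong:
  assumes "\<And>i. i \<in> Poly_Mapping.keys m \<Longrightarrow> s i = t i"
  shows "relabel s m = relabel t m"
  using assms by (simp add: relabel_def)

lemma keys_sum_nat:
  fixes h :: "'a \<Rightarrow> monomial"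
  assumes "finite A"
  shows "Poly_Mapping.keys (\<Sum>x\<in>A. h x) = (\<Union>x\<in>A. Poly_Mapping.keys (h x))"
  using assms by (induction A) (auto simp: keys_add_nat)

lemma keys_relabel: "Poly_Mapping.keys (relabel s m) = s ` Poly_Mapping.keys m"
  unfolding relabel_def by (subst keys_sum_nat) (auto simp: in_keys_iff)

lemma mono_of_Nil [simp]: "mono_of [] es = 0" "mono_of is [] = 0"
  by (simp_all add: mono_of_def)

lemma mono_of_Cons [simp]: "mono_of (i # is) (e # es) = Poly_Mapping.single i e + mono_of is es"
  by (simp add: mono_of_def)

lemma relabel_mono_of: "relabel s (mono_of is es) = mono_of (map s is) es"
proof (induction "is" arbitrary: es)
  case (Cons i "is") then show ?case by (cases es) (auto simp: relabel_add)
qed simp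

lemma keys_mono_of:
  assumes "length is = length es" "0 \<notin> set es"
  shows "Poly_Mapping.keys (mono_of is es) = set is"
  using assms by (induction "is" es rule: list_induct2) (auto simp: keys_add_nat)

lemma mdegree_mono_of:
  assumes "length is = length es"
  shows "mdegree (mono_of is es) = sum_list es"
  using assms by (induction "is" es rule: list_induct2) (auto simp: mdegree_add)

lemma monomial_eq_mono_of:
  "m = mono_of (sorted_list_of_set (Poly_Mapping.keys m))
        (map (Poly_Mapping.lookup m) (sorted_list_of_set (Poly_Mapping.keys m)))"
proof -
  have *: "mono_of xs (map h xs) = sum_list (map (\<lambda>i. Poly_Mapping.single i (h i)) xs)" for h xs
    by (induction xs) auto
  show ?thesis
    by (subst (1) monomial_expand) (simp add: * sum_list_distinct_conv_sum_set)
qed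

lemma monomial_cases:
  fixes m :: monomial
  obtains \<alpha> "is" where "sorted_wrt (<) is" "length is = length (parts \<alpha>)" "m = mono_of is (parts \<alpha>)"
proof -
  let ?k = "sorted_list_of_set (Poly_Mapping.keys m)"
  let ?e = "map (Poly_Mapping.lookup m) ?k"
  have "0 \<notin> set ?e" by (auto simp: in_keys_iff)
  then have "parts (Abs_composition ?e) = ?e" by (simp add: Abs_composition_inverse)
  with that[of ?k "Abs_composition ?e"] monomial_eq_mono_of[of m] show ?thesis
    by (auto simp: strict_sorted_list_of_set)
qed

lemma quasisymmetric_relabel_iff:
  "quasisymmetric f \<longleftrightarrow>
     (\<forall>m s. strict_mono_on (Poly_Mapping.keys m) s \<longrightarrow> f (relabel s m) = f m)"
proof (intro iffI allI impI)
  fix m :: monomial and s :: "nat \<Rightarrow> nat" assume q: "quasisymmetric f" and s: "strict_mono_on (Poly_Mapping.keys m) s"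
  obtain \<alpha> "is" where i: "sorted_wrt (<) is" "length is = length (parts \<alpha>)" "m = mono_of is (parts \<alpha>)"
    by (rule monomial_cases)
  then have k: "Poly_Mapping.keys m = set is" using keys_mono_of parts_nonzero by simp
  have "sorted_wrt (<) (map s is)"
    unfolding sorted_wrt_map
    by (rule sorted_wrt_mono_rel[OF _ i(1)]) (use s k in \<open>auto simp: strict_mono_on_def\<close>)
  with q i show "f (relabel s m) = f m"
    unfolding quasisymmetric_def i(3) relabel_mono_of by (metis length_map)
next
  assume r: "\<forall>m s. strict_mono_on (Poly_Mapping.keys m) s \<longrightarrow> f (relabel s m) = f m"
  show "quasisymmetric f"
    unfolding quasisymmetric_def
  proof (intro allI impI)
    fix \<alpha> and "is" js :: "nat list"
    assume a: "sorted_wrt (<) is \<and> sorted_wrt (<) js \<and> length is = length (parts \<alpha>)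
       \<and> length js = length (parts \<alpha>)"
    define s where "s x = js ! (THE n. n < length is \<and> is ! n = x)" for x
    have d: "distinct is" using a strict_sorted_iff by blast
    have s: "s (is ! n) = js ! n" if "n < length is" for n
    proof -
      have "(THE k. k < length is \<and> is ! k = is ! n) = n"
        using that d by (auto simp: nth_eq_iff_index_eq)
      then show ?thesis by (simp add: s_def)
    qed
    have m: "map s is = js" by (rule nth_equalityI) (use s a in auto)
    have sm: "strict_mono_on (set is) s"
    proof (rule strict_mono_onI)
      fix x y assume "x \<in> set is" "y \<in> set is" "x < y"
      then obtain n k where nk: "n < length is" "k < length is" "x = is ! n" "y = is ! k"
        by (auto simp: in_set_conv_nth)
      have "n < k"
      proof (rule ccontr)
        assume "\<not> n < k"
        then have "is ! k \<le> is ! n"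
          using a nk by (auto intro!: sorted_nth_mono simp: strict_sorted_iff)
        with nk \<open>x < y\<close> show False by simp
      qed
      with nk a show "s x < s y" by (simp add: s sorted_wrt_nth_less)
    qed
    have "Poly_Mapping.keys (mono_of is (parts \<alpha>)) = set is"
      using a parts_nonzero by (simp add: keys_mono_of)
    with r sm have "f (relabel s (mono_of is (parts \<alpha>))) = f (mono_of is (parts \<alpha>))" by simp
    then show "f (mono_of is (parts \<alpha>)) = f (mono_of js (parts \<alpha>))"
      by (simp add: relabel_mono_of m)
  qed
qed

lemma relabel_inv:
  assumes "inj_on s (Poly_Mapping.keys m)" "Poly_Mapping.keys a \<subseteq> Poly_Mapping.keys m"
  shows "relabel (inv_into (Poly_Mapping.keys m) s) (relabel s a) = a"
  using assms by (auto simp: relabel_relabel intro!: relabel_id inv_into_f_f)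

lemma quasisymmetric_series_times:
  assumes f: "quasisymmetric f" and g: "quasisymmetric g"
  shows "quasisymmetric (series_times f g)"
  unfolding quasisymmetric_relabel_iff
proof (intro allI impI)
  fix m :: monomial and s :: "nat \<Rightarrow> nat" assume s: "strict_mono_on (Poly_Mapping.keys m) s"
  let ?K = "Poly_Mapping.keys m"
  let ?t = "inv_into ?K s"
  have inj: "inj_on s ?K" using s by (rule strict_mono_on_imp_inj_on)
  have ft: "f (relabel s a) = f a" "g (relabel s a) = g a" if "Poly_Mapping.keys a \<subseteq> ?K" for a
  proof -
    have "strict_mono_on (Poly_Mapping.keys a) s"
      using s that unfolding strict_mono_on_def by blast
    then show "f (relabel s a) = f a" "g (relabel s a) = g a"
      using f g unfolding quasisymmetric_relabel_iff by blast+
  qed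
  have ts: "relabel s (relabel ?t b) = b" if "Poly_Mapping.keys b \<subseteq> s ` ?K" for b
    unfolding relabel_relabel by (rule relabel_id) (use that in \<open>auto simp: f_inv_into_f subset_iff\<close>)
  have st: "relabel ?t (relabel s a) = a" if "Poly_Mapping.keys a \<subseteq> ?K" for a
    using inj that by (rule relabel_inv)
  have *: "Poly_Mapping.keys a \<subseteq> s ` ?K" "Poly_Mapping.keys b \<subseteq> s ` ?K"
    if "a + b = relabel s m" for a b
    using arg_cong[OF that, of Poly_Mapping.keys] by (auto simp: keys_add_nat keys_relabel)
  have **: "Poly_Mapping.keys (relabel ?t b) \<subseteq> ?K" if "Poly_Mapping.keys b \<subseteq> s ` ?K" for b
    using that by (auto simp: keys_relabel intro!: inv_into_into)
  show "series_times f g (relabel s m) = series_times f g m"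
    unfolding series_times_def
  proof (rule sum.reindex_bij_witness[where i = "\<lambda>(a, b). (relabel s a, relabel s b)"
        and j = "\<lambda>(a, b). (relabel ?t a, relabel ?t b)"], goal_cases)
    case (1 p)
    then obtain a b where p: "p = (a, b)" "a + b = relabel s m" by auto
    show ?case by (simp add: p(1) ts *[OF p(2)])
  next
    case (2 p)
    then obtain a b where p: "p = (a, b)" "a + b = relabel s m" by auto
    have "relabel ?t (a + b) = m" unfolding p(2) by (rule st) simp
    then show ?case using p(1) by (simp add: relabel_add)
  next
    case (3 p)
    then obtain a b where p: "p = (a, b)" "a + b = m" by auto
    have "Poly_Mapping.keys a \<subseteq> ?K" "Poly_Mapping.keys b \<subseteq> ?K"
      by (auto simp: p(2)[symmetric] keys_add_nat)
    then show ?case by (simp add: p(1) st)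
  next
    case (4 p) then show ?case by (auto simp: relabel_add)
  next
    case (5 p)
    then obtain a b where p: "p = (a, b)" "a + b = relabel s m" by auto
    have "f (relabel ?t a) = f a" "g (relabel ?t b) = g b"
      using ft(1)[OF **, of a] ft(2)[OF **, of b] ts *[OF p(2)] by simp_all
    then show ?case by (simp add: p(1))
  qed
qed

lemma bounded_degree_series_times:
  assumes "bounded_degree f" "bounded_degree g"
  shows "bounded_degree (series_times f g)"
proof -
  obtain c where c: "\<And>m. f m \<noteq> 0 \<Longrightarrow> mdegree m \<le> c"
    using assms(1) unfolding bounded_degree_def by auto
  obtain d where d: "\<And>m. g m \<noteq> 0 \<Longrightarrow> mdegree m \<le> d"
    using assms(2) unfolding bounded_degree_def by auto
  show ?thesis unfolding bounded_degree_def
  proof (intro exI[of _ "c + d"] allI impI)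
    fix m assume "series_times f g m \<noteq> 0"
    then obtain p where "p \<in> {(a, b). a + b = m}" "(case p of (a, b) \<Rightarrow> f a * g b) \<noteq> 0"
      unfolding series_times_def by (rule sum.not_neutral_contains_not_neutral)
    then obtain a b where "a + b = m" "f a \<noteq> 0" "g b \<noteq> 0" by auto
    then show "mdegree m \<le> c + d" using c[of a] d[of b] mdegree_add[of a b] by simp
  qed
qed

lemma series_times_assoc:
  "series_times (series_times f g) h = series_times f (series_times g h)"
proof
  fix m
  let ?D = "\<lambda>m::monomial. {(a, b). a + b = m}"
  have "series_times (series_times f g) h m
      = (\<Sum>p\<in>?D m. \<Sum>q\<in>?D (fst p). f (fst q) * g (snd q) * h (snd p))"
    by (simp add: series_times_def sum_distrib_right case_prod_unfold)
  also have "\<dots> = (\<Sum>(p, q)\<in>Sigma (?D m) (\<lambda>p. ?D (fst p)). f (fst q) * g (snd q) * h (snd p))"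
    by (rule sum.Sigma) (auto simp: finite_antidiag)
  also have "\<dots> = (\<Sum>(p, q)\<in>Sigma (?D m) (\<lambda>p. ?D (snd p)). f (fst p) * (g (fst q) * h (snd q)))"
    by (rule sum.reindex_bij_witness[where
          i = "\<lambda>((a, r), (b, c)). ((a + b, c), (a, b))" and
          j = "\<lambda>((r, c), (a, b)). ((a, b + c), (b, c))"]) (auto simp: algebra_simps)
  also have "\<dots> = (\<Sum>p\<in>?D m. \<Sum>q\<in>?D (snd p). f (fst p) * (g (fst q) * h (snd q)))"
    by (rule sum.Sigma[symmetric]) (auto simp: finite_antidiag)
  also have "\<dots> = series_times f (series_times g h) m"
    by (simp add: series_times_def sum_distrib_left case_prod_unfold)
  finally show "series_times (series_times f g) h m = series_times f (series_times g h) m" .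
qed

lemma series_times_commute: "series_times f g = series_times g f"
proof
  fix m
  show "series_times f g m = series_times g f m"
    unfolding series_times_def
    by (rule sum.reindex_bij_witness[where i = "\<lambda>(a, b). (b, a)" and j = "\<lambda>(a, b). (b, a)"])
       (auto simp: add.commute)
qed

lemma series_times_one: "series_times (\<lambda>m. if m = 0 then 1 else 0) f = f"
proof
  fix m :: monomial
  have "series_times (\<lambda>m. if m = 0 then 1 else 0) f m
      = (\<Sum>(a, b)\<in>{(0 :: monomial, m)}. (if a = 0 then 1 else 0) * f b)"
    unfolding series_times_def
    by (rule sum.mono_neutral_right) (auto simp: finite_antidiag split: if_splits)
  then show "series_times (\<lambda>m. if m = 0 then 1 else 0) f m = f m" by simp
qed


section \<open>The algebra of quasisymmetric functions\<close>

typedef qsym = "{f. bounded_degree f \<and> quasisymmetric f}"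
  morphisms coeff Abs_qsym
  by (rule exI[of _ "\<lambda>_. 0"]) (auto simp: bounded_degree_def quasisymmetric_def)

setup_lifting type_definition_qsym

lemma bounded_degree_add:
  assumes "bounded_degree f" "bounded_degree g"
  shows "bounded_degree (\<lambda>m. f m + g m)"
proof -
  obtain c where c: "\<And>m. f m \<noteq> 0 \<Longrightarrow> mdegree m \<le> c"
    using assms(1) unfolding bounded_degree_def by auto
  obtain d where d: "\<And>m. g m \<noteq> 0 \<Longrightarrow> mdegree m \<le> d"
    using assms(2) unfolding bounded_degree_def by auto
  show ?thesis unfolding bounded_degree_def
    by (rule exI[of _ "max c d"]) (metis add.right_neutral c d le_max_iff_disj)
qed

lemma bounded_degree_scale: "bounded_degree f \<Longrightarrow> bounded_degree (\<lambda>m. c * f m)"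
  unfolding bounded_degree_def by (metis mult_zero_right)

instantiation qsym :: comm_ring_1
begin

lift_definition zero_qsym :: qsym is "\<lambda>_. 0"
  by (auto simp: bounded_degree_def quasisymmetric_def)

lift_definition one_qsym :: qsym is "\<lambda>m. if m = 0 then 1 else 0"
proof (intro conjI)
  show "bounded_degree (\<lambda>m. if m = 0 then 1 else 0)"
    by (auto simp: bounded_degree_def)
  have "relabel s m = 0 \<longleftrightarrow> m = 0" for s m
    by (metis image_is_empty keys_eq_empty keys_relabel)
  then show "quasisymmetric (\<lambda>m. if m = 0 then 1 else 0)"
    by (auto simp: quasisymmetric_relabel_iff)
qed

lift_definition plus_qsym :: "qsym \<Rightarrow> qsym \<Rightarrow> qsym" is "\<lambda>f g m. f m + g m"
  by (auto simp: quasisymmetric_relabel_iff intro: bounded_degree_add)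

lift_definition uminus_qsym :: "qsym \<Rightarrow> qsym" is "\<lambda>f m. - f m"
  using bounded_degree_scale[of _ "-1"] by (auto simp: quasisymmetric_relabel_iff)

definition minus_qsym :: "qsym \<Rightarrow> qsym \<Rightarrow> qsym" where
  "minus_qsym f g = f + - g"

lift_definition times_qsym :: "qsym \<Rightarrow> qsym \<Rightarrow> qsym" is series_times
  by (auto intro: bounded_degree_series_times quasisymmetric_series_times)

instance
proof
  fix a b c :: qsym
  show "a + b + c = a + (b + c)" by transfer (simp add: add.assoc)
  show "a + b = b + a" by transfer (simp add: add.commute)
  show "0 + a = a" by transfer simp
  show "- a + a = 0" by transfer simp
  show "a - b = a + - b" by (rule minus_qsym_def)
  show "a * b * c = a * (b * c)" by transfer (rule series_times_assoc)
  show "a * b = b * a" by transfer (rule series_times_commute)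
  show "1 * a = a" by transfer (rule series_times_one)
  show "(a + b) * c = a * c + b * c"
    by transfer (auto simp: series_times_def fun_eq_iff algebra_simps sum.distrib case_prod_unfold)
  show "(0::qsym) \<noteq> 1" by transfer (metis zero_neq_one)
qed

end

lift_definition scaleQ :: "rat \<Rightarrow> qsym \<Rightarrow> qsym" is "\<lambda>c f m. c * f m"
  by (auto simp: quasisymmetric_relabel_iff intro: bounded_degree_scale)

global_interpretation qsym: vector_space scaleQ
  by unfold_locales (transfer; simp add: algebra_simps fun_eq_iff)+

lemma coeff_sum: "coeff (\<Sum>x\<in>A. h x) m = (\<Sum>x\<in>A. coeff (h x) m)"
  by (induction A rule: infinite_finite_induct) (auto simp: zero_qsym.rep_eq plus_qsym.rep_eq)

subsection \<open>Monomial basis and grading\<close>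

text \<open>The coefficient of \<open>m\<close> in $M_\alpha$ is the number of index sequences
  $i_1 < \cdots < i_k$ with $x_{i_1}^{\alpha_1}\cdots x_{i_k}^{\alpha_k} = m$ (at most one,
  see \<open>coeff_M_mono_of\<close>).\<close>

lift_definition M :: "composition \<Rightarrow> qsym" is
  "\<lambda>\<alpha> m. of_nat (card {is. sorted_wrt (<) is \<and> length is = length (parts \<alpha>)
                          \<and> mono_of is (parts \<alpha>) = m})"
proof (intro conjI)
  fix \<alpha>
  let ?I = "\<lambda>m. {is. sorted_wrt (<) is \<and> length is = length (parts \<alpha>)
                          \<and> mono_of is (parts \<alpha>) = m}"
  show "bounded_degree (\<lambda>m. of_nat (card (?I m)))"
    unfolding bounded_degree_def
  proof (intro exI[of _ "csize \<alpha>"] allI impI)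
    fix m assume "rat_of_nat (card (?I m)) \<noteq> 0"
    then have "?I m \<noteq> {}" by (metis card.empty of_nat_0)
    then show "mdegree m \<le> csize \<alpha>" by (auto simp: mdegree_mono_of csize_def)
  qed
  show "quasisymmetric (\<lambda>m. of_nat (card (?I m)))"
    unfolding quasisymmetric_relabel_iff
  proof (intro allI impI)
    fix m :: monomial and s :: "nat \<Rightarrow> nat" assume s: "strict_mono_on (Poly_Mapping.keys m) s"
    let ?K = "Poly_Mapping.keys m"
    let ?t = "inv_into ?K s"
    have inj: "inj_on s ?K" using s by (rule strict_mono_on_imp_inj_on)
    have t: "strict_mono_on (s ` ?K) ?t"
      using inj s by (auto simp: strict_mono_on_def) (metis linorder_less_linear order.asym)
    have I: "set is = Poly_Mapping.keys m'" if "is \<in> ?I m'" for "is" m'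
      using that keys_mono_of parts_nonzero by auto
    have "bij_betw (map s) (?I m) (?I (relabel s m))"
    proof (rule bij_betw_byWitness[where f' = "map ?t"])
      show "\<forall>is\<in>?I m. map ?t (map s is) = is"
        using I[of _ m] inj by (auto intro!: map_idI)
      show "\<forall>is\<in>?I (relabel s m). map s (map ?t is) = is"
        using I[of _ "relabel s m"] by (auto simp: keys_relabel f_inv_into_f intro!: map_idI)
      show "map s ` ?I m \<subseteq> ?I (relabel s m)"
      proof clarify
        fix "is" assume a: "sorted_wrt (<) is" "length is = length (parts \<alpha>)" "m = mono_of is (parts \<alpha>)"
        then have "set is = ?K" by (intro I) auto
        then have "sorted_wrt (<) (map s is)"
          unfolding sorted_wrt_map
          by (intro sorted_wrt_mono_rel[OF _ a(1)]) (use s in \<open>auto simp: strict_mono_on_def\<close>)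
        then show "sorted_wrt (<) (map s is) \<and> length (map s is) = length (parts \<alpha>) \<and>
            mono_of (map s is) (parts \<alpha>) = relabel s (mono_of is (parts \<alpha>))"
          using a by (simp add: relabel_mono_of)
      qed
      show "map ?t ` ?I (relabel s m) \<subseteq> ?I m"
      proof clarify
        fix "is" assume a: "sorted_wrt (<) is" "length is = length (parts \<alpha>)"
          "mono_of is (parts \<alpha>) = relabel s m"
        then have "set is = s ` ?K" using I[of "is" "relabel s m"] by (auto simp: keys_relabel)
        then have "sorted_wrt (<) (map ?t is)"
          unfolding sorted_wrt_map
          by (intro sorted_wrt_mono_rel[OF _ a(1)]) (use t in \<open>auto simp: strict_mono_on_def\<close>)
        then show "sorted_wrt (<) (map ?t is) \<and> length (map ?t is) = length (parts \<alpha>) \<and>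
            mono_of (map ?t is) (parts \<alpha>) = m"
          using a inj by (simp add: relabel_mono_of[symmetric] relabel_inv)
      qed
    qed
    then show "rat_of_nat (card (?I (relabel s m))) = of_nat (card (?I m))"
      using bij_betw_same_card by force
  qed
qed

definition QSym_graded :: "nat \<Rightarrow> qsym set" where
  "QSym_graded n = qsym.span (M ` {\<alpha>. csize \<alpha> = n})"

lemma mono_of_inject:
  assumes "sorted_wrt (<) is" "length is = length (parts \<alpha>)"
    and "sorted_wrt (<) js" "length js = length (parts \<beta>)"
    and eq: "mono_of is (parts \<alpha>) = mono_of js (parts \<beta>)"
  shows "is = js \<and> \<alpha> = \<beta>"
proof -
  have z: "Poly_Mapping.lookup (mono_of xs gs) x = 0" if "x \<notin> set xs" for x xs gs
    using that
  proof (induction xs arbitrary: gs)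
    case (Cons y xs) then show ?case by (cases gs) (auto simp: lookup_add lookup_single)
  qed simp
  have *: "mono_of xs es = mono_of xs fs \<Longrightarrow> es = fs"
    if "length xs = length es" "length xs = length fs" "distinct xs" for xs es fs
    using that
  proof (induction xs es arbitrary: fs rule: list_induct2)
    case (Cons x xs e es)
    obtain f fs' where fs: "fs = f # fs'" using Cons by (cases fs) auto
    have "e = f"
      using arg_cong[OF Cons.prems(1), of "\<lambda>m. Poly_Mapping.lookup m x"]
        z[of x xs es] z[of x xs fs'] Cons fs by (simp add: lookup_add)
    then show ?case using Cons fs by auto
  qed auto
  have "set is = set js" using assms keys_mono_of parts_nonzero by metis
  then have "is = js" using assms by (simp add: strict_sorted_equal)
  moreover have "parts \<alpha> = parts \<beta>"
    using * assms \<open>is = js\<close> strict_sorted_iff by metis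
  ultimately show ?thesis by (simp add: parts_inject)
qed

lemma coeff_M_mono_of:
  assumes "sorted_wrt (<) is" "length is = length (parts \<beta>)"
  shows "coeff (M \<alpha>) (mono_of is (parts \<beta>)) = (if \<alpha> = \<beta> then 1 else 0)"
proof -
  have "{js. sorted_wrt (<) js \<and> length js = length (parts \<alpha>)
           \<and> mono_of js (parts \<alpha>) = mono_of is (parts \<beta>)} = (if \<alpha> = \<beta> then {is} else {})"
    using assms mono_of_inject by auto
  then show ?thesis by (simp add: M.rep_eq)
qed

text \<open>The coordinate of \<open>f\<close> at $M_\alpha$ is the coefficient of
  $x_1^{\alpha_1}\cdots x_k^{\alpha_k}$.\<close>

definition M_coord :: "qsym \<Rightarrow> composition \<Rightarrow> rat" where
  "M_coord f \<alpha> = coeff f (mono_of [0..<length (parts \<alpha>)] (parts \<alpha>))"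

lemma M_coord_M: "M_coord (M \<alpha>) \<beta> = (if \<alpha> = \<beta> then 1 else 0)"
  by (simp add: M_coord_def coeff_M_mono_of)

lemma M_coord_add: "M_coord (f + g) \<alpha> = M_coord f \<alpha> + M_coord g \<alpha>"
  by (simp add: M_coord_def plus_qsym.rep_eq)

lemma M_coord_scale: "M_coord (scaleQ c f) \<alpha> = c * M_coord f \<alpha>"
  by (simp add: M_coord_def scaleQ.rep_eq)

lemma finite_M_coord: "finite {\<alpha>. M_coord f \<alpha> \<noteq> 0}"
proof -
  obtain d where d: "\<And>m. coeff f m \<noteq> 0 \<Longrightarrow> mdegree m \<le> d"
    using coeff[of f] by (auto simp: bounded_degree_def)
  have "{\<alpha>. M_coord f \<alpha> \<noteq> 0} \<subseteq> {\<alpha>. csize \<alpha> \<le> d}"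
    by (auto simp: M_coord_def csize_def mdegree_mono_of dest!: d)
  then show ?thesis using finite_csize_le finite_subset by blast
qed

lemma M_expansion: "f = (\<Sum>\<alpha> | M_coord f \<alpha> \<noteq> 0. scaleQ (M_coord f \<alpha>) (M \<alpha>))"
proof -
  let ?g = "\<Sum>\<alpha> | M_coord f \<alpha> \<noteq> 0. scaleQ (M_coord f \<alpha>) (M \<alpha>)"
  have "coeff f m = coeff ?g m" for m
  proof -
    obtain \<beta> "is" where i: "sorted_wrt (<) is" "length is = length (parts \<beta>)" "m = mono_of is (parts \<beta>)"
      by (rule monomial_cases)
    have "coeff f m = M_coord f \<beta>"
    proof -
      have "quasisymmetric (coeff f)" using coeff[of f] by simp
      moreover have "sorted_wrt (<) [0..<length (parts \<beta>)]" "length [0..<length (parts \<beta>)] = length (parts \<beta>)"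
        by simp_all
      ultimately show ?thesis
        using i unfolding M_coord_def quasisymmetric_def by blast
    qed
    also have "\<dots> = (\<Sum>\<alpha> | M_coord f \<alpha> \<noteq> 0. if \<alpha> = \<beta> then M_coord f \<alpha> else 0)"
      using finite_M_coord[of f] by (simp add: sum.delta)
    also have "\<dots> = coeff ?g m"
      by (auto simp: coeff_sum scaleQ.rep_eq i coeff_M_mono_of intro!: sum.cong)
    finally show ?thesis .
  qed
  then show ?thesis by (simp add: coeff_inject[symmetric] fun_eq_iff)
qed

lemma M_empty: "M empty_comp = 1"
  by (simp add: coeff_inject[symmetric] fun_eq_iff M.rep_eq one_qsym.rep_eq empty_comp.rep_eq
      conj_commute cong: conj_cong)


section \<open>The tensor square\<close>

text \<open>The tensor product of the rational vector space \<open>qsym\<close> with itself: the free vector space on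
  pairs modulo the subspace spanned by the bilinearity relations.\<close>

type_synonym free_pairs = "(qsym \<times> qsym) \<Rightarrow>\<^sub>0 rat"

definition free_scale :: "rat \<Rightarrow> free_pairs \<Rightarrow> free_pairs" where
  "free_scale c p = Poly_Mapping.map ((*) c) p"

lemma lookup_free_scale: "Poly_Mapping.lookup (free_scale c p) k = c * Poly_Mapping.lookup p k"
  by (simp add: free_scale_def Poly_Mapping.map.rep_eq when_def)

global_interpretation free_pairs: vector_space free_scale
  by unfold_locales (auto intro!: poly_mapping_eqI simp: lookup_free_scale lookup_add algebra_simps)

definition bilinear_relations :: "free_pairs set" where
  "bilinear_relations =
     {Poly_Mapping.single (f + f', g) 1 - Poly_Mapping.single (f, g) 1
        - Poly_Mapping.single (f', g) 1 | f f' g. True}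
   \<union> {Poly_Mapping.single (f, g + g') 1 - Poly_Mapping.single (f, g) 1
        - Poly_Mapping.single (f, g') 1 | f g g'. True}
   \<union> {Poly_Mapping.single (scaleQ c f, g) 1 - free_scale c (Poly_Mapping.single (f, g) 1) | c f g. True}
   \<union> {Poly_Mapping.single (f, scaleQ c g) 1 - free_scale c (Poly_Mapping.single (f, g) 1) | c f g. True}"

definition tensor_rel :: "free_pairs \<Rightarrow> free_pairs \<Rightarrow> bool" where
  "tensor_rel p q \<longleftrightarrow> p - q \<in> free_pairs.span bilinear_relations"

quotient_type qsym_tensor = free_pairs / tensor_rel
proof (rule equivpI)
  show "reflp tensor_rel" by (rule reflpI) (simp add: tensor_rel_def free_pairs.span_zero)
  show "symp tensor_rel"
    by (rule sympI) (metis free_pairs.span_neg minus_diff_eq tensor_rel_def)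
  show "transp tensor_rel"
  proof (rule transpI)
    fix x y z assume "tensor_rel x y" "tensor_rel y z"
    then have "(x - y) + (y - z) \<in> free_pairs.span bilinear_relations"
      unfolding tensor_rel_def by (rule free_pairs.span_add)
    then show "tensor_rel x z" by (simp add: tensor_rel_def)
  qed
qed

instantiation qsym_tensor :: ab_group_add
begin

lift_definition zero_qsym_tensor :: qsym_tensor is 0 .

lift_definition plus_qsym_tensor :: "qsym_tensor \<Rightarrow> qsym_tensor \<Rightarrow> qsym_tensor" is "(+)"
  unfolding tensor_rel_def by (metis add_diff_add free_pairs.span_add)

lift_definition uminus_qsym_tensor :: "qsym_tensor \<Rightarrow> qsym_tensor" is uminus
  unfolding tensor_rel_def by (metis free_pairs.span_neg minus_diff_minus)

definition minus_qsym_tensor :: "qsym_tensor \<Rightarrow> qsym_tensor \<Rightarrow> qsym_tensor" where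
  "minus_qsym_tensor s t = s + - t"

instance
proof
  fix a b c :: qsym_tensor
  have refl: "tensor_rel p p" for p by (simp add: tensor_rel_def free_pairs.span_zero)
  show "a + b + c = a + (b + c)" by transfer (simp add: add.assoc refl)
  show "a + b = b + a" by transfer (simp add: add.commute refl)
  show "0 + a = a" by transfer (simp add: refl)
  show "- a + a = 0" by transfer (simp add: refl)
  show "a - b = a + - b" by (rule minus_qsym_tensor_def)
qed

end

lift_definition scaleT :: "rat \<Rightarrow> qsym_tensor \<Rightarrow> qsym_tensor" is free_scale
  unfolding tensor_rel_def by (metis free_pairs.scale_right_diff_distrib free_pairs.span_scale)

global_interpretation qsym_tensor: vector_space scaleT
proof
  have refl: "tensor_rel p p" for p by (simp add: tensor_rel_def free_pairs.span_zero)
  fix a b x y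
  show "scaleT a (x + y) = scaleT a x + scaleT a y"
    by transfer (simp add: free_pairs.scale_right_distrib refl)
  show "scaleT (a + b) x = scaleT a x + scaleT b x"
    by transfer (simp add: free_pairs.scale_left_distrib refl)
  show "scaleT a (scaleT b x) = scaleT (a * b) x" by transfer (simp add: refl)
  show "scaleT 1 x = x" by transfer (simp add: refl)
qed

definition tensor :: "qsym \<Rightarrow> qsym \<Rightarrow> qsym_tensor" (infixr \<open>\<otimes>\<close> 75) where
  "f \<otimes> g = abs_qsym_tensor (Poly_Mapping.single (f, g) 1)"

lemma tensor_add_left: "(f + f') \<otimes> g = f \<otimes> g + f' \<otimes> g"
  unfolding tensor_def plus_qsym_tensor.abs_eq qsym_tensor.abs_eq_iff tensor_rel_def
    diff_diff_eq[symmetric]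
  by (rule free_pairs.span_base) (unfold bilinear_relations_def, blast)

lemma tensor_add_right: "f \<otimes> (g + g') = f \<otimes> g + f \<otimes> g'"
  unfolding tensor_def plus_qsym_tensor.abs_eq qsym_tensor.abs_eq_iff tensor_rel_def
    diff_diff_eq[symmetric]
  by (rule free_pairs.span_base) (unfold bilinear_relations_def, blast)

lemma tensor_scale_left: "scaleQ c f \<otimes> g = scaleT c (f \<otimes> g)"
  unfolding tensor_def scaleT.abs_eq qsym_tensor.abs_eq_iff tensor_rel_def
  by (rule free_pairs.span_base) (unfold bilinear_relations_def, blast)

lemma tensor_scale_right: "f \<otimes> scaleQ c g = scaleT c (f \<otimes> g)"
  unfolding tensor_def scaleT.abs_eq qsym_tensor.abs_eq_iff tensor_rel_def
  by (rule free_pairs.span_base) (unfold bilinear_relations_def, blast)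

text \<open>\<open>tensor_map \<phi> \<psi>\<close> is $\varphi\otimes\psi$, computed on a representative; it is independent of
  that choice, and linear, when \<open>\<phi>\<close> and \<open>\<psi>\<close> are linear (\<open>tensor_map_tensor\<close>, \<open>linear_tensor_map\<close>).\<close>

definition free_extend :: "(qsym \<Rightarrow> qsym) \<Rightarrow> (qsym \<Rightarrow> qsym) \<Rightarrow> free_pairs \<Rightarrow> qsym_tensor" where
  "free_extend \<phi> \<psi> p =
     (\<Sum>(f, g)\<in>Poly_Mapping.keys p. scaleT (Poly_Mapping.lookup p (f, g)) (\<phi> f \<otimes> \<psi> g))"

definition tensor_map :: "(qsym \<Rightarrow> qsym) \<Rightarrow> (qsym \<Rightarrow> qsym) \<Rightarrow> qsym_tensor \<Rightarrow> qsym_tensor" where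
  "tensor_map \<phi> \<psi> t = free_extend \<phi> \<psi> (rep_qsym_tensor t)"

lemma free_extend_alt: "free_extend \<phi> \<psi> p =
     (\<Sum>k\<in>Poly_Mapping.keys p. scaleT (Poly_Mapping.lookup p k) (\<phi> (fst k) \<otimes> \<psi> (snd k)))"
  by (simp add: free_extend_def case_prod_unfold)

lemma linear_free_extend: "Vector_Spaces.linear free_scale scaleT (free_extend \<phi> \<psi>)"
proof
  fix p q :: free_pairs and c
  show "free_extend \<phi> \<psi> (p + q) = free_extend \<phi> \<psi> p + free_extend \<phi> \<psi> q"
    unfolding free_extend_alt
    by (rule setsum_keys_plus_distrib) (auto simp: qsym_tensor.scale_left_distrib)
  have "free_extend \<phi> \<psi> (free_scale c p) =
     (\<Sum>k\<in>Poly_Mapping.keys p. scaleT (Poly_Mapping.lookup (free_scale c p) k) (\<phi> (fst k) \<otimes> \<psi> (snd k)))"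
    unfolding free_extend_alt
    by (intro sum.mono_neutral_cong_left) (auto simp: in_keys_iff lookup_free_scale)
  then show "free_extend \<phi> \<psi> (free_scale c p) = scaleT c (free_extend \<phi> \<psi> p)"
    by (simp add: free_extend_alt lookup_free_scale qsym_tensor.scale_sum_right)
qed

lemma free_extend_single: "free_extend \<phi> \<psi> (Poly_Mapping.single (f, g) 1) = \<phi> f \<otimes> \<psi> g"
  by (simp add: free_extend_def)

lemma free_extend_cong:
  assumes \<phi>: "Vector_Spaces.linear scaleQ scaleQ \<phi>" and \<psi>: "Vector_Spaces.linear scaleQ scaleQ \<psi>"
    and pq: "tensor_rel p q"
  shows "free_extend \<phi> \<psi> p = free_extend \<phi> \<psi> q"
proof -
  interpret E: Vector_Spaces.linear free_scale scaleT "free_extend \<phi> \<psi>" by (rule linear_free_extend)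
  interpret F: Vector_Spaces.linear scaleQ scaleQ \<phi> by (rule \<phi>)
  interpret G: Vector_Spaces.linear scaleQ scaleQ \<psi> by (rule \<psi>)
  have "free_extend \<phi> \<psi> r = 0" if "r \<in> bilinear_relations" for r
    using that unfolding bilinear_relations_def
    by (auto simp: E.diff E.scale free_extend_single F.add G.add F.scale G.scale
        tensor_add_left tensor_add_right tensor_scale_left tensor_scale_right)
  then have "free_extend \<phi> \<psi> (p - q) = 0"
    using pq E.eq_0_on_span unfolding tensor_rel_def by blast
  then show ?thesis by (simp add: E.diff)
qed

lemma tensor_map_abs:
  assumes "Vector_Spaces.linear scaleQ scaleQ \<phi>" "Vector_Spaces.linear scaleQ scaleQ \<psi>"
  shows "tensor_map \<phi> \<psi> (abs_qsym_tensor p) = free_extend \<phi> \<psi> p"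
proof -
  have "tensor_rel (rep_qsym_tensor (abs_qsym_tensor p)) p"
    using Quotient3_qsym_tensor Quotient3_rep_abs qsym_tensor.abs_eq_iff
    by (metis Quotient3_abs_rep)
  then show ?thesis unfolding tensor_map_def by (rule free_extend_cong[OF assms])
qed

lemma tensor_map_tensor:
  assumes "Vector_Spaces.linear scaleQ scaleQ \<phi>" "Vector_Spaces.linear scaleQ scaleQ \<psi>"
  shows "tensor_map \<phi> \<psi> (f \<otimes> g) = \<phi> f \<otimes> \<psi> g"
  unfolding tensor_def[of f g] tensor_map_abs[OF assms] free_extend_single ..

lemma linear_tensor_map:
  assumes "Vector_Spaces.linear scaleQ scaleQ \<phi>" "Vector_Spaces.linear scaleQ scaleQ \<psi>"
  shows "Vector_Spaces.linear scaleT scaleT (tensor_map \<phi> \<psi>)"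
proof
  interpret E: Vector_Spaces.linear free_scale scaleT "free_extend \<phi> \<psi>" by (rule linear_free_extend)
  fix s t c
  obtain p q where s: "s = abs_qsym_tensor p" and t: "t = abs_qsym_tensor q"
    using Quotient3_abs_rep[OF Quotient3_qsym_tensor] by metis
  show "tensor_map \<phi> \<psi> (s + t) = tensor_map \<phi> \<psi> s + tensor_map \<phi> \<psi> t"
    by (simp add: s t plus_qsym_tensor.abs_eq tensor_map_abs[OF assms] E.add)
  show "tensor_map \<phi> \<psi> (scaleT c s) = scaleT c (tensor_map \<phi> \<psi> s)"
    by (simp add: s scaleT.abs_eq tensor_map_abs[OF assms] E.scale)
qed


section \<open>Coalgebra structure and Hopf algebra automorphisms\<close>

text \<open>Linear extensions from the monomial basis.\<close>

definition comult :: "qsym \<Rightarrow> qsym_tensor" where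
  "comult f = (\<Sum>\<alpha> | M_coord f \<alpha> \<noteq> 0.
     scaleT (M_coord f \<alpha>) (\<Sum>(\<beta>, \<gamma>)\<in>deconcatenations \<alpha>. M \<beta> \<otimes> M \<gamma>))"

definition counit :: "qsym \<Rightarrow> rat" where
  "counit f = M_coord f empty_comp"

lemma comult_M: "comult (M \<alpha>) = (\<Sum>(\<beta>, \<gamma>)\<in>deconcatenations \<alpha>. M \<beta> \<otimes> M \<gamma>)"
  by (simp add: comult_def M_coord_M)

lemma linear_comult: "Vector_Spaces.linear scaleQ scaleT comult"
proof
  have *: "comult f = (\<Sum>\<alpha>\<in>A. scaleT (M_coord f \<alpha>) (\<Sum>(\<beta>, \<gamma>)\<in>deconcatenations \<alpha>. M \<beta> \<otimes> M \<gamma>))"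
    if "finite A" "{\<alpha>. M_coord f \<alpha> \<noteq> 0} \<subseteq> A" for f A
    unfolding comult_def using that by (intro sum.mono_neutral_left) auto
  fix f g c
  let ?A = "{\<alpha>. M_coord f \<alpha> \<noteq> 0} \<union> {\<alpha>. M_coord g \<alpha> \<noteq> 0}"
  have fin: "finite ?A" using finite_M_coord by simp
  show "comult (f + g) = comult f + comult g"
    by (subst (1 2 3) *[OF fin])
       (auto simp: M_coord_add qsym_tensor.scale_left_distrib sum.distrib)
  show "comult (scaleQ c f) = scaleT c (comult f)"
    by (subst (1 2) *[OF fin])
       (auto simp: M_coord_scale qsym_tensor.scale_sum_right)
qed

lemma counit_M: "counit (M \<alpha>) = (if \<alpha> = empty_comp then 1 else 0)"
  by (simp add: counit_def M_coord_M)

lemma linear_counit: "Vector_Spaces.linear scaleQ (*) counit"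
  by unfold_locales (auto simp: counit_def M_coord_add M_coord_scale algebra_simps)

text \<open>Preservation of the antipode is automatic for a bialgebra map between Hopf algebras, and
  likewise the inverse of a bijective bialgebra map is again one.\<close>

definition hopf_endomorphism :: "(qsym \<Rightarrow> qsym) \<Rightarrow> bool" where
  "hopf_endomorphism \<phi> \<longleftrightarrow>
     Vector_Spaces.linear scaleQ scaleQ \<phi>
   \<and> \<phi> 1 = 1 \<and> (\<forall>f g. \<phi> (f * g) = \<phi> f * \<phi> g)
   \<and> (\<forall>f. counit (\<phi> f) = counit f)
   \<and> (\<forall>f. comult (\<phi> f) = tensor_map \<phi> \<phi> (comult f))"

definition hopf_automorphism :: "(qsym \<Rightarrow> qsym) \<Rightarrow> bool" where
  "hopf_automorphism \<phi> \<longleftrightarrow> hopf_endomorphism \<phi> \<and> bij \<phi>"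

definition graded_map :: "(qsym \<Rightarrow> qsym) \<Rightarrow> bool" where
  "graded_map \<phi> \<longleftrightarrow> (\<forall>n. \<phi> ` QSym_graded n \<subseteq> QSym_graded n)"


section \<open>Quasisymmetric Schur functions\<close>

text \<open>Rows and columns are numbered from \<open>0\<close>.\<close>

definition cells :: "composition \<Rightarrow> (nat \<times> nat) set" where
  "cells \<alpha> = {(i, j). i < length (parts \<alpha>) \<and> j < parts \<alpha> ! i}"

definition SSRCT :: "composition \<Rightarrow> (nat \<times> nat \<Rightarrow> nat) set" where
  "SSRCT \<alpha> = {\<tau> \<in> cells \<alpha> \<rightarrow>\<^sub>E {1..}.
     (\<forall>i j k. (i, j) \<in> cells \<alpha> \<and> (i, k) \<in> cells \<alpha> \<and> j \<le> k \<longrightarrow> \<tau> (i, j) \<ge> \<tau> (i, k))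
   \<and> (\<forall>i j. (i, 0) \<in> cells \<alpha> \<and> (j, 0) \<in> cells \<alpha> \<and> i < j \<longrightarrow> \<tau> (i, 0) < \<tau> (j, 0))
   \<and> (\<forall>i j k. i < j \<and> (i, k) \<in> cells \<alpha> \<and> (j, k + 1) \<in> cells \<alpha> \<and> \<tau> (i, k) \<ge> \<tau> (j, k + 1)
        \<longrightarrow> (i, k + 1) \<in> cells \<alpha> \<and> \<tau> (i, k + 1) > \<tau> (j, k + 1))}"

text \<open>The entry \<open>v\<close> contributes the variable $x_v$, whose key is \<open>v - 1\<close>.\<close>

definition tableau_monomial :: "composition \<Rightarrow> (nat \<times> nat \<Rightarrow> nat) \<Rightarrow> monomial" where
  "tableau_monomial \<alpha> \<tau> = (\<Sum>c\<in>cells \<alpha>. Poly_Mapping.single (\<tau> c - 1) 1)"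

lemma finite_cells: "finite (cells \<alpha>)"
proof -
  have "cells \<alpha> = Sigma {..<length (parts \<alpha>)} (\<lambda>i. {..<parts \<alpha> ! i})"
    by (auto simp: cells_def)
  then show ?thesis by simp
qed

lemma keys_tableau_monomial:
  "Poly_Mapping.keys (tableau_monomial \<alpha> \<tau>) = (\<lambda>c. \<tau> c - 1) ` cells \<alpha>"
  unfolding tableau_monomial_def by (subst keys_sum_nat) (auto simp: finite_cells)

lemma finite_SSRCT_monomial: "finite {\<tau> \<in> SSRCT \<alpha>. tableau_monomial \<alpha> \<tau> = m}"
proof (rule finite_subset)
  show "{\<tau> \<in> SSRCT \<alpha>. tableau_monomial \<alpha> \<tau> = m} \<subseteq> PiE (cells \<alpha>) (\<lambda>_. Suc ` Poly_Mapping.keys m)"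
  proof
    fix \<tau> assume t: "\<tau> \<in> {\<tau> \<in> SSRCT \<alpha>. tableau_monomial \<alpha> \<tau> = m}"
    then have p: "\<tau> \<in> cells \<alpha> \<rightarrow>\<^sub>E {1..}" by (simp add: SSRCT_def)
    show "\<tau> \<in> PiE (cells \<alpha>) (\<lambda>_. Suc ` Poly_Mapping.keys m)"
    proof (rule PiE_I)
      fix c assume c: "c \<in> cells \<alpha>"
      have "\<tau> c = Suc (\<tau> c - 1)" using p c by (metis PiE_mem Suc_pred' atLeast_iff less_eq_Suc_le One_nat_def)
      moreover have "\<tau> c - 1 \<in> Poly_Mapping.keys m"
        using t c keys_tableau_monomial[of \<alpha> \<tau>] by auto
      ultimately show "\<tau> c \<in> Suc ` Poly_Mapping.keys m" by (rule image_eqI)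
    qed (use p in auto)
  qed
  show "finite (PiE (cells \<alpha>) (\<lambda>_. Suc ` Poly_Mapping.keys m))"
    by (intro finite_PiE finite_cells) simp
qed

lemma SSRCT_relabel:
  assumes t: "\<tau> \<in> SSRCT \<alpha>"
    and s: "strict_mono_on (Poly_Mapping.keys (tableau_monomial \<alpha> \<tau>)) s"
  defines "\<tau>' \<equiv> \<lambda>c\<in>cells \<alpha>. Suc (s (\<tau> c - 1))"
  shows "\<tau>' \<in> SSRCT \<alpha>" "tableau_monomial \<alpha> \<tau>' = relabel s (tableau_monomial \<alpha> \<tau>)"
proof -
  have pos: "\<tau> c \<ge> 1" if "c \<in> cells \<alpha>" for c
    using t that by (auto simp: SSRCT_def)
  have s': "strict_mono_on ((\<lambda>c. \<tau> c - 1) ` cells \<alpha>) s"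
    using s by (simp add: keys_tableau_monomial)
  have less: "\<tau>' c < \<tau>' d \<longleftrightarrow> \<tau> c < \<tau> d" if "c \<in> cells \<alpha>" "d \<in> cells \<alpha>" for c d
  proof -
    have "s (\<tau> c - 1) < s (\<tau> d - 1) \<longleftrightarrow> \<tau> c - 1 < \<tau> d - 1"
      using that by (intro strict_mono_on_less[OF s']) auto
    then show ?thesis using that pos[OF that(1)] pos[OF that(2)] by (auto simp: \<tau>'_def)
  qed
  then have le: "\<tau>' c \<le> \<tau>' d \<longleftrightarrow> \<tau> c \<le> \<tau> d" if "c \<in> cells \<alpha>" "d \<in> cells \<alpha>" for c d
    using that by (metis linorder_not_less)
  have "\<tau>' \<in> cells \<alpha> \<rightarrow>\<^sub>E {1..}" by (auto simp: \<tau>'_def)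
  then show "\<tau>' \<in> SSRCT \<alpha>"
    using t unfolding SSRCT_def by (simp add: less le) (metis less le)
  show "tableau_monomial \<alpha> \<tau>' = relabel s (tableau_monomial \<alpha> \<tau>)"
    unfolding tableau_monomial_def relabel_sum by (simp add: \<tau>'_def)
qed

text \<open>The coefficient of \<open>m\<close> is the number of tableaux \<open>\<tau>\<close> of shape \<open>\<alpha>\<close> with $x^\tau = m$
  (finite by \<open>finite_SSRCT_monomial\<close>).\<close>

lift_definition S :: "composition \<Rightarrow> qsym" is
  "\<lambda>\<alpha> m. of_nat (card {\<tau> \<in> SSRCT \<alpha>. tableau_monomial \<alpha> \<tau> = m})"
proof (intro conjI)
  fix \<alpha>
  let ?T = "\<lambda>m. {\<tau> \<in> SSRCT \<alpha>. tableau_monomial \<alpha> \<tau> = m}"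
  show "bounded_degree (\<lambda>m. of_nat (card (?T m)))"
    unfolding bounded_degree_def
  proof (intro exI[of _ "card (cells \<alpha>)"] allI impI)
    fix m assume "rat_of_nat (card (?T m)) \<noteq> 0"
    then have "?T m \<noteq> {}" by (metis card.empty of_nat_0)
    then show "mdegree m \<le> card (cells \<alpha>)" by (auto simp: tableau_monomial_def mdegree_sum)
  qed
  show "quasisymmetric (\<lambda>m. of_nat (card (?T m)))"
    unfolding quasisymmetric_relabel_iff
  proof (intro allI impI)
    fix m :: monomial and s :: "nat \<Rightarrow> nat" assume s: "strict_mono_on (Poly_Mapping.keys m) s"
    let ?K = "Poly_Mapping.keys m"
    let ?t = "inv_into ?K s"
    let ?F = "\<lambda>s \<tau>. \<lambda>c\<in>cells \<alpha>. Suc (s (\<tau> c - 1))"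
    have inj: "inj_on s ?K" using s by (rule strict_mono_on_imp_inj_on)
    have t: "strict_mono_on (s ` ?K) ?t"
      using inj s by (auto simp: strict_mono_on_def) (metis linorder_less_linear order.asym)
    have K: "\<tau> c - 1 \<in> Poly_Mapping.keys m'" if "\<tau> \<in> ?T m'" "c \<in> cells \<alpha>" for \<tau> m' c
      using that keys_tableau_monomial[of \<alpha> \<tau>] by auto
    have ext: "?F (\<lambda>x. x) \<tau> = \<tau>" if "\<tau> \<in> SSRCT \<alpha>" for \<tau>
    proof
      fix c
      have p: "\<tau> \<in> cells \<alpha> \<rightarrow>\<^sub>E {1..}" using that by (simp add: SSRCT_def)
      show "?F (\<lambda>x. x) \<tau> c = \<tau> c"
        using PiE_mem[OF p, of c] PiE_arb[OF p, of c] by (cases "c \<in> cells \<alpha>") auto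
    qed
    have "bij_betw (?F s) (?T m) (?T (relabel s m))"
    proof (rule bij_betw_byWitness[where f' = "?F ?t"])
      show "\<forall>\<tau>\<in>?T m. ?F ?t (?F s \<tau>) = \<tau>"
      proof
        fix \<tau> assume a: "\<tau> \<in> ?T m"
        have "?F ?t (?F s \<tau>) = ?F (\<lambda>x. x) \<tau>"
          by (rule restrict_ext) (simp add: inv_into_f_f[OF inj K[OF a]] del: One_nat_def)
        with a ext show "?F ?t (?F s \<tau>) = \<tau>" by simp
      qed
      show "\<forall>\<tau>\<in>?T (relabel s m). ?F s (?F ?t \<tau>) = \<tau>"
      proof
        fix \<tau> assume a: "\<tau> \<in> ?T (relabel s m)"
        have "?F s (?F ?t \<tau>) = ?F (\<lambda>x. x) \<tau>"
          by (rule restrict_ext) (simp add: f_inv_into_f[OF K[OF a, unfolded keys_relabel]] del: One_nat_def)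
        with a ext show "?F s (?F ?t \<tau>) = \<tau>" by simp
      qed
      show "?F s ` ?T m \<subseteq> ?T (relabel s m)"
      proof (rule image_subsetI)
        fix \<tau> assume "\<tau> \<in> ?T m"
        then have a: "\<tau> \<in> SSRCT \<alpha>" "tableau_monomial \<alpha> \<tau> = m" by auto
        with s have "strict_mono_on (Poly_Mapping.keys (tableau_monomial \<alpha> \<tau>)) s" by simp
        from SSRCT_relabel[OF a(1) this] a(2) show "?F s \<tau> \<in> ?T (relabel s m)" by simp
      qed
      show "?F ?t ` ?T (relabel s m) \<subseteq> ?T m"
      proof (rule image_subsetI)
        fix \<tau> assume "\<tau> \<in> ?T (relabel s m)"
        then have a: "\<tau> \<in> SSRCT \<alpha>" "tableau_monomial \<alpha> \<tau> = relabel s m" by auto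
        then have "strict_mono_on (Poly_Mapping.keys (tableau_monomial \<alpha> \<tau>)) ?t"
          using t by (simp add: keys_relabel)
        from SSRCT_relabel[OF a(1) this] a inj show "?F ?t \<tau> \<in> ?T m"
          by (simp add: relabel_inv)
      qed
    qed
    then show "rat_of_nat (card (?T (relabel s m))) = of_nat (card (?T m))"
      using bij_betw_same_card by force
  qed
qed

end

theory Submission
  imports Defs "HOL-Library.Multiset"
begin

text \<open>
  Write \<open>coord \<beta>\<close> for the functional taking \<open>f\<close> to its coefficient at \<open>M \<beta>\<close>.  Because
  the coproduct deconcatenates, these functionals multiply in the dual algebra by concatenating
  compositions (\<open>convolution_coord\<close>), so the graded dual algebra is generated by the functionals
  \<open>coord (n)\<close> of one-row compositions.  The transpose of a coalgebra map is multiplicative;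
  hence \<open>\<phi> = id\<close> as soon as \<open>\<phi>\<close> preserves every \<open>coord (n)\<close>
  (\<open>coord_fixed_if_row_coords_fixed\<close>).

  A tableau whose entries all equal 1 has a single row, by strictness of the first column, so
  \<open>coord (n)\<close> takes the value 1 on \<open>S (n)\<close> and 0 on every other \<open>S \<alpha>\<close>.  Since the
  \<open>S \<alpha>\<close> span and \<open>\<phi>\<close> permutes them, preserving \<open>coord (n)\<close> amounts to
  \<open>\<phi> (S (n)) = S (n)\<close>.  The spanning statement comes from unitriangularity of the
  matrix expressing the \<open>S \<alpha>\<close> in the \<open>M \<beta>\<close> (\<open>M_in_span_S\<close>).

  That \<open>\<phi>\<close> fixes \<open>S (n)\<close> is proved by induction on \<open>n\<close>.  Write \<open>\<phi> (S (n)) = S \<alpha>\<close>.  By the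
  induction hypothesis \<open>\<phi>\<close> preserves \<open>coord \<beta>\<close> for all \<open>\<beta>\<close> with parts below \<open>n\<close>, so \<open>S \<alpha>\<close>
  has the same coefficients as \<open>S (n)\<close> at all \<open>\<beta> \<noteq> (n)\<close> of size \<open>n\<close>, namely 1.  For
  \<open>n \<ge> 3\<close> no shape other than \<open>(n)\<close> carries tableaux of both contents \<open>(1, n - 1)\<close> and
  \<open>(n - 1, 1)\<close> (\<open>only_row_has_both_hooks\<close>).  For \<open>n = 1\<close> there is only one composition of
  that size.

  For \<open>n = 2\<close> the map \<open>\<phi>\<close> might exchange \<open>S (2)\<close> and \<open>S (1,1)\<close>, and the contradiction
  appears only in degree 4 (\<open>no_swap_in_degree_2\<close>).  The exchange means that the transpose of
  \<open>\<phi>\<close> sends \<open>coord (2)\<close> to \<open>coord (1,1) - coord (2)\<close>, which determines it on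
  \<open>coord (2,2)\<close> and \<open>coord (1,2,1)\<close>.  Applied to
  \<open>S (1,2,1) = M (1,2,1) + M (1,1,1,1)\<close> this says that its image has coefficient 1 at
  \<open>M (2,2)\<close> and 0 at \<open>M (1,2,1)\<close>.  But each of the three shapes with a tableau of content
  \<open>(2,2)\<close>, which are \<open>(4)\<close>, \<open>(2,2)\<close> and \<open>(1,3)\<close>, also has one of content \<open>(1,2,1)\<close>.
\<close>

section \<open>Compositions\<close>

abbreviation of_parts :: "nat list \<Rightarrow> composition" where
  "of_parts \<equiv> Abs_composition"

lemma parts_of_parts [simp]: "0 \<notin> set xs \<Longrightarrow> parts (of_parts xs) = xs"
  by (simp add: Abs_composition_inverse)

lemma composition_eqI: "parts \<alpha> = parts \<beta> \<Longrightarrow> \<alpha> = \<beta>"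
  by (simp add: parts_inject)

lemma concat_of_parts:
  assumes "0 \<notin> set xs" "0 \<notin> set ys"
  shows "concat_comp (of_parts xs) (of_parts ys) = of_parts (xs @ ys)"
  using assms by (intro composition_eqI) (simp add: concat_comp.rep_eq)

lemma length_le_csize: "length (parts \<alpha>) \<le> csize \<alpha>"
proof -
  have "length xs \<le> sum_list xs" if "0 \<notin> set xs" for xs :: "nat list"
    using that by (induction xs) auto
  then show ?thesis using parts_nonzero by (simp add: csize_def)
qed

lemma csize_of_parts: "0 \<notin> set xs \<Longrightarrow> csize (of_parts xs) = sum_list xs"
  by (simp add: csize_def)

lemma eq_of_partsI: "parts \<alpha> = xs \<Longrightarrow> \<alpha> = of_parts xs"
  by (metis parts_inverse)

lemma length_le_1_imp_row:
  assumes "length (parts \<alpha>) \<le> 1" "csize \<alpha> = n" "1 \<le> n"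
  shows "\<alpha> = of_parts [n]"
  using assms by (intro eq_of_partsI) (cases "parts \<alpha>"; auto simp: csize_def)

lemma length_le_2_cases:
  assumes "length (parts \<alpha>) \<le> 2" "csize \<alpha> = n" "1 \<le> n"
  obtains "\<alpha> = of_parts [n]" | a b where "\<alpha> = of_parts [a, b]" "1 \<le> a" "1 \<le> b" "a + b = n"
proof (cases "length (parts \<alpha>) \<le> 1")
  case True
  then show ?thesis using length_le_1_imp_row assms that(1) by blast
next
  case False
  with assms(1) have "length (parts \<alpha>) = Suc (Suc 0)" by simp
  then obtain a b where ab: "parts \<alpha> = [a, b]"
    by (auto simp: length_Suc_conv)
  then show ?thesis
    using assms(2) parts_nonzero[of \<alpha>] by (intro that(2) eq_of_partsI) (auto simp: csize_def)
qed

lemma csize_2_cases: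
  assumes "csize \<alpha> = 2"
  shows "\<alpha> = of_parts [2] \<or> \<alpha> = of_parts [1, 1]"
proof -
  have "length (parts \<alpha>) \<le> 2" using length_le_csize[of \<alpha>] assms by simp
  then show ?thesis using assms
  proof (rule length_le_2_cases)
    fix a b :: nat assume "\<alpha> = of_parts [a, b]" "1 \<le> a" "1 \<le> b" "a + b = 2"
    moreover from this have "a = 1" "b = 1" by simp_all
    ultimately show ?thesis by simp
  qed auto
qed


section \<open>Convolution of functionals\<close>

abbreviation rat_linear :: "(qsym \<Rightarrow> rat) \<Rightarrow> bool" where
  "rat_linear \<equiv> Vector_Spaces.linear scaleQ (*)"

definition free_functional :: "(qsym \<Rightarrow> rat) \<Rightarrow> (qsym \<Rightarrow> rat) \<Rightarrow> free_pairs \<Rightarrow> rat" where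
  "free_functional u v p =
     (\<Sum>k\<in>Poly_Mapping.keys p. Poly_Mapping.lookup p k * (u (fst k) * v (snd k)))"

text \<open>The functional $u \<otimes> v$ on the tensor square, computed on a representative; for linear
  \<open>u\<close> and \<open>v\<close> it does not depend on the choice (\<open>tensor_functional_abs\<close>).\<close>

definition tensor_functional :: "(qsym \<Rightarrow> rat) \<Rightarrow> (qsym \<Rightarrow> rat) \<Rightarrow> qsym_tensor \<Rightarrow> rat" where
  "tensor_functional u v t = free_functional u v (rep_qsym_tensor t)"

lemma linear_free_functional: "Vector_Spaces.linear free_scale (*) (free_functional u v)"
proof
  fix p q :: free_pairs and c
  show "free_functional u v (p + q) = free_functional u v p + free_functional u v q"
    unfolding free_functional_def
    by (rule setsum_keys_plus_distrib) (auto simp: algebra_simps)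
  have "free_functional u v (free_scale c p) =
     (\<Sum>k\<in>Poly_Mapping.keys p. Poly_Mapping.lookup (free_scale c p) k * (u (fst k) * v (snd k)))"
    unfolding free_functional_def
    by (intro sum.mono_neutral_cong_left) (auto simp: in_keys_iff lookup_free_scale)
  then show "free_functional u v (free_scale c p) = c * free_functional u v p"
    by (simp add: free_functional_def lookup_free_scale sum_distrib_left mult.assoc)
qed (simp_all add: algebra_simps)

lemma free_functional_single [simp]:
  "free_functional u v (Poly_Mapping.single (f, g) 1) = u f * v g"
  by (simp add: free_functional_def)

lemma tensor_functional_abs:
  assumes u: "rat_linear u" and v: "rat_linear v"
  shows "tensor_functional u v (abs_qsym_tensor p) = free_functional u v p"
proof -
  interpret E: Vector_Spaces.linear free_scale "(*)" "free_functional u v"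
    by (rule linear_free_functional)
  interpret U: Vector_Spaces.linear scaleQ "(*)" u by (rule u)
  interpret V: Vector_Spaces.linear scaleQ "(*)" v by (rule v)
  let ?q = "rep_qsym_tensor (abs_qsym_tensor p)"
  have "tensor_rel ?q p"
    using Quotient3_qsym_tensor Quotient3_rep_abs qsym_tensor.abs_eq_iff
    by (metis Quotient3_abs_rep)
  moreover have "free_functional u v r = 0" if "r \<in> bilinear_relations" for r
    using that unfolding bilinear_relations_def
    by (auto simp: E.diff E.scale U.add V.add U.scale V.scale distrib_left distrib_right)
  ultimately have "free_functional u v (?q - p) = 0"
    using E.eq_0_on_span unfolding tensor_rel_def by blast
  then show ?thesis by (simp add: E.diff tensor_functional_def)
qed

lemma tensor_functional_tensor:
  assumes "rat_linear u" "rat_linear v"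
  shows "tensor_functional u v (f \<otimes> g) = u f * v g"
  by (simp add: tensor_def tensor_functional_abs[OF assms])

lemma linear_tensor_functional:
  assumes "rat_linear u" "rat_linear v"
  shows "Vector_Spaces.linear scaleT (*) (tensor_functional u v)"
proof
  interpret E: Vector_Spaces.linear free_scale "(*)" "free_functional u v"
    by (rule linear_free_functional)
  fix s t c
  obtain p q where s: "s = abs_qsym_tensor p" and t: "t = abs_qsym_tensor q"
    using Quotient3_abs_rep[OF Quotient3_qsym_tensor] by metis
  show "tensor_functional u v (s + t) = tensor_functional u v s + tensor_functional u v t"
    by (simp add: s t plus_qsym_tensor.abs_eq tensor_functional_abs[OF assms] E.add)
  show "tensor_functional u v (scaleT c s) = c * tensor_functional u v s"
    by (simp add: s scaleT.abs_eq tensor_functional_abs[OF assms] E.scale)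
qed (simp_all add: algebra_simps)

lemma tensor_functional_tensor_map:
  assumes \<phi>: "Vector_Spaces.linear scaleQ scaleQ \<phi>" and u: "rat_linear u" and v: "rat_linear v"
  shows "tensor_functional u v (tensor_map \<phi> \<phi> t) = tensor_functional (u \<circ> \<phi>) (v \<circ> \<phi>) t"
proof -
  interpret T: Vector_Spaces.linear scaleT "(*)" "tensor_functional u v"
    using u v by (rule linear_tensor_functional)
  obtain p where t: "t = abs_qsym_tensor p"
    using Quotient3_abs_rep[OF Quotient3_qsym_tensor] by metis
  have lin: "rat_linear (u \<circ> \<phi>)" "rat_linear (v \<circ> \<phi>)"
    using Vector_Spaces.linear_compose[OF \<phi> u] Vector_Spaces.linear_compose[OF \<phi> v] by auto
  show ?thesis
    by (simp add: t tensor_map_abs[OF \<phi> \<phi>] tensor_functional_abs[OF lin] free_extend_alt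
        free_functional_def T.sum T.scale tensor_functional_tensor[OF u v])
qed

text \<open>The product of the algebra dual to the coalgebra of quasisymmetric functions.\<close>

definition convolution :: "(qsym \<Rightarrow> rat) \<Rightarrow> (qsym \<Rightarrow> rat) \<Rightarrow> qsym \<Rightarrow> rat" (infixl \<open>\<star>\<close> 70) where
  "(u \<star> v) f = tensor_functional u v (comult f)"

lemma convolution_diff_left: "((\<lambda>f. u f - u' f) \<star> v) = (\<lambda>f. (u \<star> v) f - (u' \<star> v) f)"
  by (simp add: fun_eq_iff convolution_def tensor_functional_def free_functional_def
      algebra_simps sum_subtractf)

lemma convolution_diff_right: "(u \<star> (\<lambda>f. v f - v' f)) = (\<lambda>f. (u \<star> v) f - (u \<star> v') f)"
  by (simp add: fun_eq_iff convolution_def tensor_functional_def free_functional_def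
      algebra_simps sum_subtractf)

abbreviation coord :: "composition \<Rightarrow> qsym \<Rightarrow> rat" where
  "coord \<beta> \<equiv> \<lambda>f. M_coord f \<beta>"

lemma linear_coord: "rat_linear (coord \<beta>)"
  by unfold_locales (auto simp: M_coord_add M_coord_scale algebra_simps)

text \<open>A composition \<open>\<alpha>\<close> deconcatenates into the ordered pair \<open>(\<beta>, \<gamma>)\<close> exactly once when
  \<open>\<alpha> = \<beta> \<cdot> \<gamma>\<close> and never otherwise.  The graded dual algebra is thus the free algebra on the
  functionals of one-row compositions.\<close>

lemma convolution_coord: "coord \<beta> \<star> coord \<gamma> = coord (concat_comp \<beta> \<gamma>)"
proof
  fix f
  interpret T: Vector_Spaces.linear scaleT "(*)" "tensor_functional (coord \<beta>) (coord \<gamma>)"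
    by (intro linear_tensor_functional linear_coord)
  have cut: "(\<Sum>(\<beta>', \<gamma>')\<in>deconcatenations \<alpha>. M_coord (M \<beta>') \<beta> * M_coord (M \<gamma>') \<gamma>)
      = (if \<alpha> = concat_comp \<beta> \<gamma> then 1 else 0)" (is "?s = _") for \<alpha>
  proof -
    have "?s = (\<Sum>p\<in>deconcatenations \<alpha>. if p = (\<beta>, \<gamma>) then 1 else 0)"
      by (intro sum.cong) (auto simp: M_coord_M split: if_splits)
    also have "\<dots> = (if (\<beta>, \<gamma>) \<in> deconcatenations \<alpha> then 1 else 0)"
      using finite_deconcatenations by (simp add: sum.delta)
    finally show ?thesis by (simp add: deconcatenations_def)
  qed
  have "(coord \<beta> \<star> coord \<gamma>) f = (\<Sum>\<alpha> | M_coord f \<alpha> \<noteq> 0. M_coord f \<alpha> *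
      (\<Sum>(\<beta>', \<gamma>')\<in>deconcatenations \<alpha>. M_coord (M \<beta>') \<beta> * M_coord (M \<gamma>') \<gamma>))"
    by (simp add: convolution_def comult_def T.sum T.scale case_prod_unfold
        tensor_functional_tensor[OF linear_coord linear_coord])
  also have "\<dots> = (\<Sum>\<alpha> | M_coord f \<alpha> \<noteq> 0. if \<alpha> = concat_comp \<beta> \<gamma> then M_coord f \<alpha> else 0)"
    by (intro sum.cong) (auto simp: cut)
  also have "\<dots> = M_coord f (concat_comp \<beta> \<gamma>)"
    using finite_M_coord[of f] by (simp add: sum.delta)
  finally show "(coord \<beta> \<star> coord \<gamma>) f = M_coord f (concat_comp \<beta> \<gamma>)" .
qed

lemma convolution_hopf_endomorphism:
  assumes \<phi>: "hopf_endomorphism \<phi>" and "rat_linear u" "rat_linear v"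
  shows "(u \<star> v) \<circ> \<phi> = (u \<circ> \<phi>) \<star> (v \<circ> \<phi>)"
  using assms tensor_functional_tensor_map[of \<phi> u v]
  by (simp add: fun_eq_iff hopf_endomorphism_def convolution_def)

lemma coord_concat_hopf_endomorphism:
  assumes "hopf_endomorphism \<phi>"
  shows "coord (concat_comp \<beta> \<gamma>) \<circ> \<phi> = (coord \<beta> \<circ> \<phi>) \<star> (coord \<gamma> \<circ> \<phi>)"
  using convolution_hopf_endomorphism[OF assms linear_coord[of \<beta>] linear_coord[of \<gamma>]]
  by (simp add: convolution_coord)

text \<open>The transpose of \<open>\<phi>\<close> is an algebra map, so it fixes every product of generators that it
  fixes.  The bound \<open>N\<close> lets this serve inside an induction on the degree.\<close>

lemma coord_fixed_if_row_coords_fixed: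
  assumes \<phi>: "hopf_endomorphism \<phi>"
    and row: "\<And>n. 1 \<le> n \<Longrightarrow> n \<le> N \<Longrightarrow> coord (of_parts [n]) \<circ> \<phi> = coord (of_parts [n])"
    and "\<forall>n\<in>set (parts \<beta>). n \<le> N"
  shows "coord \<beta> \<circ> \<phi> = coord \<beta>"
proof -
  have "coord (of_parts xs) \<circ> \<phi> = coord (of_parts xs)"
    if "0 \<notin> set xs" "\<forall>n\<in>set xs. n \<le> N" for xs
    using that
  proof (induction xs)
    case Nil
    have "of_parts [] = empty_comp"
      by (rule composition_eqI) (simp add: empty_comp.rep_eq)
    then show ?case using \<phi> by (simp add: fun_eq_iff hopf_endomorphism_def counit_def)
  next
    case (Cons n xs)
    then have "of_parts (n # xs) = concat_comp (of_parts [n]) (of_parts xs)"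
      by (subst concat_of_parts) auto
    moreover have "coord (of_parts [n]) \<circ> \<phi> = coord (of_parts [n])"
      using Cons.prems by (intro row) auto
    moreover have "coord (of_parts xs) \<circ> \<phi> = coord (of_parts xs)"
      by (rule Cons.IH) (use Cons.prems in auto)
    ultimately show ?case
      using coord_concat_hopf_endomorphism[OF \<phi>, of "of_parts [n]" "of_parts xs"]
      by (simp only: convolution_coord)
  qed
  from this[of "parts \<beta>"] show ?thesis using assms(3) parts_nonzero by (simp add: parts_inverse)
qed


section \<open>Tableaux of given shape and content\<close>

text \<open>The tableaux of shape \<open>\<alpha>\<close> with \<open>\<beta>\<^sub>i\<close> entries equal to \<open>i\<close>; their number is the
  coefficient of \<open>S \<alpha>\<close> at \<open>M \<beta>\<close>.\<close>

definition tableaux :: "composition \<Rightarrow> composition \<Rightarrow> (nat \<times> nat \<Rightarrow> nat) set" where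
  "tableaux \<alpha> \<beta> = {\<tau> \<in> SSRCT \<alpha>.
     tableau_monomial \<alpha> \<tau> = mono_of [0..<length (parts \<beta>)] (parts \<beta>)}"

lemma coord_S: "M_coord (S \<alpha>) \<beta> = of_nat (card (tableaux \<alpha> \<beta>))"
  by (simp add: M_coord_def S.rep_eq tableaux_def)

lemma coord_S_neq_0_iff: "M_coord (S \<alpha>) \<beta> \<noteq> 0 \<longleftrightarrow> tableaux \<alpha> \<beta> \<noteq> {}"
  using finite_SSRCT_monomial by (simp add: coord_S tableaux_def)

lemma lookup_mono_of_upt:
  "Poly_Mapping.lookup (mono_of [0..<length es] es) v = (if v < length es then es ! v else 0)"
proof (induction es rule: rev_induct)
  case (snoc e es)
  have "mono_of ([0..<length es] @ [length es]) (es @ [e])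
      = mono_of [0..<length es] es + Poly_Mapping.single (length es) e"
    by (simp add: mono_of_def)
  then show ?case using snoc by (auto simp: lookup_add lookup_single nth_append when_def)
qed simp

lemma SSRCT_PiE: "\<tau> \<in> SSRCT \<alpha> \<Longrightarrow> \<tau> \<in> cells \<alpha> \<rightarrow>\<^sub>E {1..}"
  unfolding SSRCT_def by blast

lemma SSRCT_positive: "\<tau> \<in> SSRCT \<alpha> \<Longrightarrow> c \<in> cells \<alpha> \<Longrightarrow> 1 \<le> \<tau> c"
  by (drule SSRCT_PiE) (drule (1) PiE_mem, simp)

text \<open>The consequence of the third tableau condition that rules out fillings: where row \<open>i\<close>
  ends, the entries of lower rows in the next column must exceed its last entry.\<close>

lemma SSRCT_triple:
  assumes t: "\<tau> \<in> SSRCT \<alpha>" and "i < j"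
    and c: "(i, k) \<in> cells \<alpha>" "(j, Suc k) \<in> cells \<alpha>" "(i, Suc k) \<notin> cells \<alpha>"
  shows "\<tau> (i, k) < \<tau> (j, Suc k)"
proof -
  have "\<forall>i j k. i < j \<and> (i, k) \<in> cells \<alpha> \<and> (j, k + 1) \<in> cells \<alpha> \<and> \<tau> (i, k) \<ge> \<tau> (j, k + 1)
      \<longrightarrow> (i, k + 1) \<in> cells \<alpha>"
    using t unfolding SSRCT_def by blast
  from this[rule_format, of i j k] show ?thesis using assms(2) c by force
qed

lemma tableaux_iff:
  "\<tau> \<in> tableaux \<alpha> \<beta> \<longleftrightarrow> \<tau> \<in> SSRCT \<alpha> \<and>
     (\<forall>v. card {c \<in> cells \<alpha>. \<tau> c = Suc v} = (if v < length (parts \<beta>) then parts \<beta> ! v else 0))"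
proof (cases "\<tau> \<in> SSRCT \<alpha>")
  case True
  have "Poly_Mapping.lookup (tableau_monomial \<alpha> \<tau>) v = card {c \<in> cells \<alpha>. \<tau> c = Suc v}" for v
  proof -
    have "Poly_Mapping.lookup (tableau_monomial \<alpha> \<tau>) v = (\<Sum>c\<in>cells \<alpha>. if \<tau> c = Suc v then 1 else 0)"
      unfolding tableau_monomial_def lookup_sum lookup_single when_def
    proof (rule sum.cong)
      fix c assume "c \<in> cells \<alpha>"
      then have "\<tau> c - 1 = v \<longleftrightarrow> \<tau> c = Suc v" using SSRCT_positive[OF True, of c] by linarith
      then show "(if \<tau> c - 1 = v then 1 else 0) = (if \<tau> c = Suc v then 1 else 0::nat)" by simp
    qed simp
    then show ?thesis
      using finite_cells[of \<alpha>] by (simp only: card_eq_sum sum.inter_filter)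
  qed
  then show ?thesis
    using True by (simp add: tableaux_def poly_mapping_eq_iff fun_eq_iff lookup_mono_of_upt)
qed (simp add: tableaux_def)

lemma tableaux_SSRCT: "\<tau> \<in> tableaux \<alpha> \<beta> \<Longrightarrow> \<tau> \<in> SSRCT \<alpha>"
  by (simp add: tableaux_def)

lemma tableaux_count:
  "\<tau> \<in> tableaux \<alpha> \<beta> \<Longrightarrow> v < length (parts \<beta>) \<Longrightarrow> card {c \<in> cells \<alpha>. \<tau> c = Suc v} = parts \<beta> ! v"
  by (simp add: tableaux_iff)

lemma tableaux_bounds:
  assumes t: "\<tau> \<in> tableaux \<alpha> \<beta>" and c: "c \<in> cells \<alpha>"
  shows "1 \<le> \<tau> c" "\<tau> c \<le> length (parts \<beta>)"
proof -
  show p: "1 \<le> \<tau> c" using SSRCT_positive tableaux_SSRCT t c by blast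
  let ?D = "{d \<in> cells \<alpha>. \<tau> d = Suc (\<tau> c - 1)}"
  have "finite ?D" using finite_cells[of \<alpha>] by simp
  moreover have "c \<in> ?D" using c p by simp
  ultimately have "card ?D \<noteq> 0" by (metis card_0_eq empty_iff)
  then have "\<tau> c - 1 < length (parts \<beta>)"
    using t unfolding tableaux_iff by metis
  then show "\<tau> c \<le> length (parts \<beta>)" using p by simp
qed

lemma cells_Sigma: "cells \<alpha> = Sigma {..<length (parts \<alpha>)} (\<lambda>i. {..<parts \<alpha> ! i})"
  by (auto simp: cells_def)

lemma card_cells: "card (cells \<alpha>) = csize \<alpha>"
  by (simp add: cells_Sigma csize_def sum_list_sum_nth atLeast0LessThan)

lemma tableaux_csize: 
  assumes "\<tau> \<in> tableaux \<alpha> \<beta>"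
  shows "csize \<beta> = csize \<alpha>"
proof -
  have "mdegree (tableau_monomial \<alpha> \<tau>) = csize \<alpha>"
    by (simp add: tableau_monomial_def mdegree_sum card_cells)
  moreover have "mdegree (tableau_monomial \<alpha> \<tau>) = csize \<beta>"
    using assms by (simp add: tableaux_def mdegree_mono_of csize_def)
  ultimately show ?thesis by simp
qed

lemma first_column_cell: "i < length (parts \<alpha>) \<Longrightarrow> (i, 0) \<in> cells \<alpha>"
  using parts_nonzero[of \<alpha>] by (auto simp: cells_def in_set_conv_nth gr0_conv_Suc intro: Nat.gr0I)

lemma SSRCT_first_column:
  assumes t: "\<tau> \<in> SSRCT \<alpha>" and "i \<le> j" "j < length (parts \<alpha>)"
  shows "\<tau> (i, 0) + (j - i) \<le> \<tau> (j, 0)"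
  using assms(2,3)
proof (induction j rule: dec_induct)
  case (step j)
  have "\<forall>i j. (i, 0) \<in> cells \<alpha> \<and> (j, 0) \<in> cells \<alpha> \<and> i < j \<longrightarrow> \<tau> (i, 0) < \<tau> (j, 0)"
    using t unfolding SSRCT_def by blast
  then have "\<tau> (j, 0) < \<tau> (Suc j, 0)"
    using first_column_cell[of j \<alpha>] first_column_cell[of "Suc j" \<alpha>] step.prems by simp
  then show ?case using step by simp
qed simp

lemma SSRCT_row_le_first:
  assumes "\<tau> \<in> SSRCT \<alpha>" "(i, j) \<in> cells \<alpha>"
  shows "\<tau> (i, j) \<le> \<tau> (i, 0)"
proof -
  have "(i, 0) \<in> cells \<alpha>" using assms(2) by (auto simp: cells_def)
  then show ?thesis using assms unfolding SSRCT_def by blast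
qed

text \<open>The first column has distinct entries among the values that the content allows.\<close>

lemma tableaux_length_le:
  assumes t: "\<tau> \<in> tableaux \<alpha> \<beta>"
  shows "length (parts \<alpha>) \<le> length (parts \<beta>)"
proof (cases "parts \<alpha> = []")
  case False
  let ?k = "length (parts \<alpha>)"
  have k: "?k - 1 < ?k" using False by simp
  have "\<tau> (0, 0) + (?k - 1 - 0) \<le> \<tau> (?k - 1, 0)"
    by (rule SSRCT_first_column[OF tableaux_SSRCT[OF t] _ k]) simp
  moreover have "1 \<le> \<tau> (0, 0)" "\<tau> (?k - 1, 0) \<le> length (parts \<beta>)"
    using tableaux_bounds[OF t] first_column_cell False k by auto
  ultimately show ?thesis by simp
qed simp

text \<open>When shape and content have the same length \<open>k\<close>, the first column must be \<open>1, \<dots>, k\<close>,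
  and rows decrease from there.\<close>

lemma tableaux_row_bound:
  assumes t: "\<tau> \<in> tableaux \<alpha> \<beta>" and len: "length (parts \<beta>) = length (parts \<alpha>)"
    and c: "(i, j) \<in> cells \<alpha>"
  shows "\<tau> (i, j) \<le> Suc i"
proof -
  let ?k = "length (parts \<alpha>)"
  have i: "i < ?k" using c by (simp add: cells_def)
  have "\<tau> (i, 0) + (?k - 1 - i) \<le> \<tau> (?k - 1, 0)"
    by (rule SSRCT_first_column[OF tableaux_SSRCT[OF t]]) (use i in auto)
  moreover have "\<tau> (?k - 1, 0) \<le> ?k"
    using tableaux_bounds(2)[OF t first_column_cell, of "?k - 1"] i len by simp
  ultimately show ?thesis
    using SSRCT_row_le_first[OF tableaux_SSRCT[OF t] c] i by simp
qed

lemma csize_if_coord_S: "M_coord (S \<alpha>) \<beta> \<noteq> 0 \<Longrightarrow> csize \<beta> = csize \<alpha>"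
  using tableaux_csize coord_S_neq_0_iff by blast


section \<open>Triangularity and spanning\<close>

text \<open>The sum of the entries of the filling that puts \<open>i\<close> into every cell of row \<open>i\<close>, and
  also of any tableau of content \<open>\<alpha>\<close> (\<open>tableaux_entry_sum\<close>).\<close>

definition row_weight :: "composition \<Rightarrow> nat" where
  "row_weight \<alpha> = (\<Sum>i<length (parts \<alpha>). Suc i * parts \<alpha> ! i)"

lemma row_weight_cells: "row_weight \<alpha> = (\<Sum>c\<in>cells \<alpha>. Suc (fst c))"
proof -
  have "(\<Sum>c\<in>cells \<alpha>. Suc (fst c)) = (\<Sum>i<length (parts \<alpha>). \<Sum>j<parts \<alpha> ! i. Suc i)"
    unfolding cells_Sigma by (subst sum.Sigma) (auto intro!: sum.cong)
  then show ?thesis by (simp add: row_weight_def mult.commute)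
qed

lemma tableaux_entry_sum:
  assumes t: "\<tau> \<in> tableaux \<alpha> \<beta>"
  shows "(\<Sum>c\<in>cells \<alpha>. \<tau> c) = row_weight \<beta>"
proof -
  have "(\<Sum>c\<in>cells \<alpha>. \<tau> c) = (\<Sum>v<length (parts \<beta>). sum \<tau> {c \<in> cells \<alpha>. \<tau> c - 1 = v})"
    by (rule sum.group[symmetric]) (use finite_cells tableaux_bounds[OF t] in fastforce)+
  also have "\<dots> = (\<Sum>v<length (parts \<beta>). Suc v * parts \<beta> ! v)"
  proof (intro sum.cong refl)
    fix v assume v: "v \<in> {..<length (parts \<beta>)}"
    have "{c \<in> cells \<alpha>. \<tau> c - 1 = v} = {c \<in> cells \<alpha>. \<tau> c = Suc v}"
      using tableaux_bounds(1)[OF t] by force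
    then show "sum \<tau> {c \<in> cells \<alpha>. \<tau> c - 1 = v} = Suc v * parts \<beta> ! v"
      using tableaux_count[OF t, of v] v by simp
  qed
  finally show ?thesis by (simp add: row_weight_def)
qed

text \<open>Among tableaux whose content has the length of the shape, the filling with \<open>i\<close> in row \<open>i\<close>
  dominates entrywise.  Equality of weights forces that filling, and thereby \<open>\<beta> = \<alpha>\<close>
  (\<open>tableaux_row_weight_eq_imp_eq\<close>).\<close>

lemma tableaux_row_weight_le:
  assumes t: "\<tau> \<in> tableaux \<alpha> \<beta>" and len: "length (parts \<beta>) = length (parts \<alpha>)"
  shows "row_weight \<beta> \<le> row_weight \<alpha>"
proof -
  have "(\<Sum>c\<in>cells \<alpha>. \<tau> c) \<le> (\<Sum>c\<in>cells \<alpha>. Suc (fst c))"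
    by (rule sum_mono) (use tableaux_row_bound[OF t len] in auto)
  then show ?thesis by (simp only: tableaux_entry_sum[OF t] row_weight_cells[of \<alpha>])
qed

lemma tableaux_row_weight_eq:
  assumes t: "\<tau> \<in> tableaux \<alpha> \<beta>" and len: "length (parts \<beta>) = length (parts \<alpha>)"
    and w: "row_weight \<beta> = row_weight \<alpha>" and c: "c \<in> cells \<alpha>"
  shows "\<tau> c = Suc (fst c)"
proof (rule ccontr)
  assume "\<tau> c \<noteq> Suc (fst c)"
  then have "\<tau> c < Suc (fst c)"
    using tableaux_row_bound[OF t len, of "fst c" "snd c"] c by simp
  then have "(\<Sum>c\<in>cells \<alpha>. \<tau> c) < (\<Sum>c\<in>cells \<alpha>. Suc (fst c))"
    by (intro sum_strict_mono_ex1 finite_cells)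
       (use c tableaux_row_bound[OF t len] in auto)
  then show False
    using w by (simp add: tableaux_entry_sum[OF t] row_weight_cells)
qed

lemma card_row: "i < length (parts \<alpha>) \<Longrightarrow> card {c \<in> cells \<alpha>. fst c = i} = parts \<alpha> ! i"
proof -
  assume "i < length (parts \<alpha>)"
  then have "{c \<in> cells \<alpha>. fst c = i} = {i} \<times> {..<parts \<alpha> ! i}"
    by (auto simp: cells_def)
  then show ?thesis by (simp add: card_cartesian_product)
qed

lemma tableaux_row_weight_eq_imp_eq:
  assumes t: "\<tau> \<in> tableaux \<alpha> \<beta>" and len: "length (parts \<beta>) = length (parts \<alpha>)"
    and w: "row_weight \<beta> = row_weight \<alpha>"
  shows "\<beta> = \<alpha>"
proof (intro composition_eqI nth_equalityI len)
  fix i assume i: "i < length (parts \<beta>)"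
  have "{c \<in> cells \<alpha>. \<tau> c = Suc i} = {c \<in> cells \<alpha>. fst c = i}"
    using tableaux_row_weight_eq[OF t len w] by auto
  then show "parts \<beta> ! i = parts \<alpha> ! i"
    using tableaux_count[OF t i] card_row[of i \<alpha>] i len by simp
qed

lemma tableaux_self: "tableaux \<alpha> \<alpha> = {\<lambda>c\<in>cells \<alpha>. Suc (fst c)}"
proof (rule set_eqI)
  fix \<tau>
  have "\<tau> = (\<lambda>c\<in>cells \<alpha>. Suc (fst c))" if t: "\<tau> \<in> tableaux \<alpha> \<alpha>"
  proof
    fix c show "\<tau> c = (\<lambda>c\<in>cells \<alpha>. Suc (fst c)) c"
      using tableaux_row_weight_eq[OF t refl refl, of c] PiE_arb[OF SSRCT_PiE[OF tableaux_SSRCT[OF t]], of c]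
      by (cases "c \<in> cells \<alpha>") auto
  qed
  moreover have "(\<lambda>c\<in>cells \<alpha>. Suc (fst c)) \<in> tableaux \<alpha> \<alpha>"
  proof -
    have "card {c \<in> cells \<alpha>. fst c = v} = 0" if "\<not> v < length (parts \<alpha>)" for v
    proof -
      have "{c \<in> cells \<alpha>. fst c = v} = {}" using that by (auto simp: cells_def)
      then show ?thesis by (simp only: card.empty)
    qed
    moreover have "{c \<in> cells \<alpha>. (\<lambda>c\<in>cells \<alpha>. Suc (fst c)) c = Suc v} = {c \<in> cells \<alpha>. fst c = v}" for v
      by auto
    ultimately show ?thesis
      unfolding tableaux_iff by (auto simp: SSRCT_def card_row)
  qed
  ultimately show "\<tau> \<in> tableaux \<alpha> \<alpha> \<longleftrightarrow> \<tau> \<in> {\<lambda>c\<in>cells \<alpha>. Suc (fst c)}" by blast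
qed

lemma coord_S_self: "M_coord (S \<alpha>) \<alpha> = 1"
  by (simp add: coord_S tableaux_self)

lemma row_weight_of_parts:
  "0 \<notin> set xs \<Longrightarrow> row_weight (of_parts xs) = (\<Sum>i<length xs. Suc i * xs ! i)"
  by (simp add: row_weight_def)

text \<open>\<open>S \<alpha>\<close> is \<open>M \<alpha>\<close> plus terms \<open>M \<beta>\<close> where \<open>\<beta>\<close> is longer than \<open>\<alpha>\<close>, or as long but of
  smaller weight.  Within one degree lengths are bounded by the size, so \<open>M \<alpha>\<close> can be solved for
  recursively.\<close>

lemma M_in_span_S: "M \<alpha> \<in> qsym.span (range S)"
proof (induction \<alpha> rule: wf_induct_rule[OF wf_inv_image[OF wf_lex_prod[OF wf_less_than wf_less_than],
        of "\<lambda>\<alpha>. (csize \<alpha> - length (parts \<alpha>), row_weight \<alpha>)"]])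
  case (1 \<alpha>)
  have IH: "M \<beta> \<in> qsym.span (range S)" if nz: "M_coord (S \<alpha>) \<beta> \<noteq> 0" and ne: "\<beta> \<noteq> \<alpha>" for \<beta>
  proof -
    obtain \<tau> where t: "\<tau> \<in> tableaux \<alpha> \<beta>" using nz coord_S_neq_0_iff by auto
    have "length (parts \<alpha>) \<noteq> length (parts \<beta>) \<or> row_weight \<alpha> \<noteq> row_weight \<beta>"
      using tableaux_row_weight_eq_imp_eq[OF t] ne by metis
    then show ?thesis
      using tableaux_length_le[OF t] tableaux_row_weight_le[OF t] tableaux_csize[OF t]
        length_le_csize[of \<beta>]
      by (intro 1; cases "length (parts \<alpha>) = length (parts \<beta>)") auto
  qed
  let ?A = "{\<beta>. M_coord (S \<alpha>) \<beta> \<noteq> 0}"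
  have "S \<alpha> = (\<Sum>\<beta>\<in>?A. scaleQ (M_coord (S \<alpha>) \<beta>) (M \<beta>))" by (rule M_expansion)
  also have "\<dots> = M \<alpha> + (\<Sum>\<beta>\<in>?A - {\<alpha>}. scaleQ (M_coord (S \<alpha>) \<beta>) (M \<beta>))"
    by (subst sum.remove[of _ \<alpha>]) (auto simp: finite_M_coord coord_S_self)
  finally have "M \<alpha> = S \<alpha> - (\<Sum>\<beta>\<in>?A - {\<alpha>}. scaleQ (M_coord (S \<alpha>) \<beta>) (M \<beta>))"
    by (simp add: algebra_simps)
  also have "\<dots> \<in> qsym.span (range S)"
  proof (rule qsym.span_diff)
    show "(\<Sum>\<beta>\<in>?A - {\<alpha>}. scaleQ (M_coord (S \<alpha>) \<beta>) (M \<beta>)) \<in> qsym.span (range S)"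
      by (intro qsym.span_sum qsym.span_scale) (auto intro: IH)
  qed (auto intro: qsym.span_base)
  finally show ?case .
qed

lemma span_S: "f \<in> qsym.span (range S)"
  by (subst M_expansion) (intro qsym.span_sum qsym.span_scale M_in_span_S)

lemma functional_eq_on_span:
  assumes u: "rat_linear u" and v: "rat_linear v"
    and "\<And>b. b \<in> B \<Longrightarrow> u b = v b" and "f \<in> qsym.span B"
  shows "u f = v f"
proof -
  interpret U: Vector_Spaces.linear scaleQ "(*)" u by (rule u)
  interpret V: Vector_Spaces.linear scaleQ "(*)" v by (rule v)
  show ?thesis using assms(4)
    by (induction rule: qsym.span_induct_alt) (auto simp: U.add V.add U.scale V.scale assms(3))
qed

lemma functional_eq_if_eq_on_S:
  assumes "rat_linear u" "rat_linear v" "\<And>\<alpha>. u (S \<alpha>) = v (S \<alpha>)"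
  shows "u = v"
proof
  fix f show "u f = v f"
    by (rule functional_eq_on_span[OF assms(1,2) _ span_S]) (use assms(3) in auto)
qed


section \<open>One-row shapes\<close>

text \<open>A tableau of content \<open>(n)\<close> has all entries 1, and its first column is strict.\<close>

lemma coord_S_row_content:
  assumes n: "1 \<le> n"
  shows "M_coord (S \<alpha>) (of_parts [n]) = (if \<alpha> = of_parts [n] then 1 else 0)"
proof (cases "tableaux \<alpha> (of_parts [n]) = {}")
  case True
  then show ?thesis using coord_S_neq_0_iff coord_S_self by (metis zero_neq_one)
next
  case False
  then obtain \<tau> where t: "\<tau> \<in> tableaux \<alpha> (of_parts [n])" by auto
  have "\<alpha> = of_parts [n]"
    by (rule length_le_1_imp_row[OF _ _ n])
       (use tableaux_length_le[OF t] tableaux_csize[OF t] n in \<open>simp_all add: csize_of_parts\<close>)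
  then show ?thesis by (simp add: coord_S_self)
qed

lemma cells_row: "1 \<le> n \<Longrightarrow> cells (of_parts [n]) = {0} \<times> {..<n}"
  by (auto simp: cells_def)

text \<open>The entries, with multiplicity, of any tableau of content \<open>\<beta>\<close>.\<close>

definition content_mset :: "composition \<Rightarrow> nat multiset" where
  "content_mset \<beta> = (\<Sum>i<length (parts \<beta>). replicate_mset (parts \<beta> ! i) (Suc i))"

lemma count_content_mset:
  "count (content_mset \<beta>) x =
     (case x of 0 \<Rightarrow> 0 | Suc v \<Rightarrow> if v < length (parts \<beta>) then parts \<beta> ! v else 0)"
  by (auto simp: content_mset_def count_sum split: nat.split)

lemma size_content_mset: "size (content_mset \<beta>) = csize \<beta>"
  by (simp add: content_mset_def csize_def sum_list_sum_nth atLeast0LessThan)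

text \<open>For a single row only the monotonicity condition is left, so a tableau is a decreasing
  arrangement of its multiset of entries.\<close>

lemma row_tableaux_iff:
  assumes n: "1 \<le> n"
  defines "row \<equiv> \<lambda>\<tau>::nat \<times> nat \<Rightarrow> nat. map (\<lambda>j. \<tau> (0, j)) [0..<n]"
  shows "\<tau> \<in> tableaux (of_parts [n]) \<beta> \<longleftrightarrow>
     \<tau> \<in> extensional ({0} \<times> {..<n}) \<and> sorted (rev (row \<tau>)) \<and> mset (row \<tau>) = content_mset \<beta>"
proof -
  have count: "count (mset (row \<tau>)) x = card {c \<in> cells (of_parts [n]). \<tau> c = x}" for x
  proof -
    have "{c \<in> cells (of_parts [n]). \<tau> c = x} = Pair 0 ` {j. j < n \<and> \<tau> (0, j) = x}"
      using cells_row[OF n] by auto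
    moreover have "{j. j < n \<and> \<tau> (0, j) = x} = {j. j < length (row \<tau>) \<and> x = row \<tau> ! j}"
      by (auto simp: row_def)
    ultimately show ?thesis
      by (simp add: count_mset count_list_eq_length_filter length_filter_conv_card card_image inj_on_def)
  qed
  have sorted: "sorted (rev (row \<tau>)) \<longleftrightarrow> (\<forall>j k. j \<le> k \<and> k < n \<longrightarrow> \<tau> (0, k) \<le> \<tau> (0, j))"
    unfolding sorted_rev_iff_nth_mono by (auto simp: row_def)
  have SSRCT: "\<tau> \<in> SSRCT (of_parts [n]) \<longleftrightarrow>
      \<tau> \<in> ({0} \<times> {..<n}) \<rightarrow>\<^sub>E {1..} \<and> (\<forall>j k. j \<le> k \<and> k < n \<longrightarrow> \<tau> (0, k) \<le> \<tau> (0, j))"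
    unfolding SSRCT_def cells_row[OF n] by auto
  have "(\<forall>x. count (mset (row \<tau>)) x = count (content_mset \<beta>) x) \<longleftrightarrow>
      card {c \<in> cells (of_parts [n]). \<tau> c = 0} = 0 \<and>
      (\<forall>v. card {c \<in> cells (of_parts [n]). \<tau> c = Suc v} = (if v < length (parts \<beta>) then parts \<beta> ! v else 0))"
  proof -
    have all_nat: "(\<forall>x. P x) \<longleftrightarrow> P 0 \<and> (\<forall>v. P (Suc v))" for P :: "nat \<Rightarrow> bool"
      by (metis nat.exhaust)
    show ?thesis unfolding count count_content_mset by (subst all_nat) simp
  qed
  moreover have "card {c \<in> cells (of_parts [n]). \<tau> c = 0} = 0 \<longleftrightarrow> (\<forall>c\<in>{0} \<times> {..<n}. 1 \<le> \<tau> c)"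
    using finite_cells[of "of_parts [n]"] by (auto simp: cells_row[OF n] Suc_le_eq)
  ultimately show ?thesis
    unfolding tableaux_iff SSRCT sorted multiset_eq_iff by (auto simp: PiE_def Pi_def)
qed

text \<open>A multiset has exactly one decreasing arrangement.  Equivalently, \<open>S (n)\<close> is the complete
  homogeneous symmetric function, the sum of all \<open>M \<beta>\<close> of degree \<open>n\<close>.\<close>

lemma coord_S_row:
  assumes n: "1 \<le> n" and size: "csize \<beta> = n"
  shows "M_coord (S (of_parts [n])) \<beta> = 1"
proof -
  let ?xs = "rev (sorted_list_of_multiset (content_mset \<beta>))"
  let ?f = "\<lambda>c\<in>{0 :: nat} \<times> {..<n}. ?xs ! snd c"
  have len: "length ?xs = n"
    using size size_content_mset[of \<beta>] by (metis length_rev mset_sorted_list_of_multiset size_mset)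
  have row: "map (\<lambda>j. ?f (0, j)) [0..<n] = ?xs"
    by (rule nth_equalityI) (use len in auto)
  have "tableaux (of_parts [n]) \<beta> = {?f}"
  proof (rule set_eqI, unfold singleton_iff, rule iffI)
    fix \<tau> assume t: "\<tau> \<in> tableaux (of_parts [n]) \<beta>"
    let ?ys = "map (\<lambda>j. \<tau> (0, j)) [0..<n]"
    have ys: "sorted (rev ?ys)" "mset ?ys = content_mset \<beta>"
      and ext: "\<tau> \<in> extensional ({0} \<times> {..<n})"
      using t row_tableaux_iff[OF n] by blast+
    then have "?ys = ?xs"
      by (metis mset_rev rev_rev_ident sorted_list_of_multiset_mset sorted_sort_id)
    then have "\<tau> (0, j) = ?xs ! j" if "j < n" for j
      using that by (metis (no_types, lifting) add_0 diff_zero length_upt nth_map nth_upt)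
    then show "\<tau> = ?f"
      using ext by (intro extensionalityI[of _ "{0} \<times> {..<n}"]) auto
  next
    fix \<tau> assume f: "\<tau> = ?f"
    show "\<tau> \<in> tableaux (of_parts [n]) \<beta>"
      unfolding row_tableaux_iff[OF n] f row by simp
  qed
  then show ?thesis by (simp add: coord_S)
qed


section \<open>Shapes recognised by a few contents\<close>

text \<open>If the first row is a single cell, then 1 is ruled out in the rest of the first column,
  and by the triple condition also in the second cell of row two.  This limits the number of
  entries 1.\<close>

lemma tableaux_short_first_row:
  assumes t: "\<tau> \<in> tableaux \<alpha> \<beta>" and \<alpha>: "parts \<alpha> = 1 # m # es" and m: "2 \<le> m"
  shows "parts \<beta> ! 0 + length (parts \<alpha>) \<le> csize \<alpha>"
proof -
  let ?D = "{c \<in> cells \<alpha>. \<tau> c = Suc 0}"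
  let ?C = "(\<lambda>i. (i, 0 :: nat)) ` {1..<length (parts \<alpha>)}"
  let ?E = "insert (1, 1) ?C"
  have S: "\<tau> \<in> SSRCT \<alpha>" using t by (rule tableaux_SSRCT)
  have c00: "(0, 0) \<in> cells \<alpha>" and c11: "(1, 1) \<in> cells \<alpha>" and c01: "(0, 1) \<notin> cells \<alpha>"
    using \<alpha> m by (auto simp: cells_def)
  have E: "?E \<subseteq> cells \<alpha>" using c11 first_column_cell[of _ \<alpha>] by auto
  have "card ?C = length (parts \<alpha>) - 1" by (simp add: card_image inj_on_def)
  then have cardE: "card ?E = length (parts \<alpha>)" using \<alpha> by (subst card_insert_disjoint) auto
  have "0 < length (parts \<beta>)" using tableaux_length_le[OF t] \<alpha> by (cases "parts \<beta>") auto
  then have cardD: "card ?D = parts \<beta> ! 0" using tableaux_count[OF t] by simp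
  have p: "1 \<le> \<tau> (0, 0)" using S c00 by (rule SSRCT_positive)
  have "\<tau> (i, 0) \<noteq> 1" if "1 \<le> i" "i < length (parts \<alpha>)" for i
    using SSRCT_first_column[OF S, of 0 i] that p by simp
  moreover have "\<tau> (1, 1) \<noteq> 1"
    using SSRCT_triple[OF S, of 0 1 0] c00 c11 c01 p by simp
  ultimately have "?D \<inter> ?E = {}" by auto
  then have "card ?D + card ?E = card (?D \<union> ?E)"
    using finite_cells[of \<alpha>] by (intro card_Un_disjoint[symmetric]) auto
  also have "\<dots> \<le> card (cells \<alpha>)"
    using E by (intro card_mono finite_cells) auto
  finally show ?thesis unfolding cardE cardD card_cells .
qed

text \<open>A two-row shape with content \<open>(1, n - 1)\<close> can only be \<open>(1, n - 1)\<close>, by comparing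
  weights, and there at most \<open>n - 2\<close> entries can be 1.\<close>

lemma only_row_has_both_hooks:
  assumes n: "3 \<le> n"
    and 1: "M_coord (S \<alpha>) (of_parts [1, n - 1]) \<noteq> 0" and 2: "M_coord (S \<alpha>) (of_parts [n - 1, 1]) \<noteq> 0"
  shows "\<alpha> = of_parts [n]"
proof -
  obtain \<sigma> \<tau> where s: "\<sigma> \<in> tableaux \<alpha> (of_parts [1, n - 1])" and t: "\<tau> \<in> tableaux \<alpha> (of_parts [n - 1, 1])"
    using 1 2 coord_S_neq_0_iff by blast
  have size: "csize \<alpha> = n" using tableaux_csize[OF s] n by (simp add: csize_of_parts)
  have "length (parts \<alpha>) \<le> 2" using tableaux_length_le[OF s] n by simp
  then show ?thesis
  proof (rule length_le_2_cases[OF _ size])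
    show "1 \<le> n" using n by simp
  next
    fix a b assume ab: "\<alpha> = of_parts [a, b]" "1 \<le> a" "1 \<le> b" "a + b = n"
    then have "row_weight (of_parts [1, n - 1]) \<le> row_weight \<alpha>"
      using n by (intro tableaux_row_weight_le[OF s]) simp
    then have "1 + 2 * (n - 1) \<le> a + 2 * b"
      using ab n by (simp add: row_weight_of_parts)
    then have "a = 1" "2 \<le> b" using ab n by linarith+
    then have "(n - 1) + 2 \<le> csize \<alpha>"
      using tableaux_short_first_row[OF t, of b "[]"] ab n by simp
    then show ?thesis using size n by simp
  qed
qed

lemma cells_121: "cells (of_parts [1, 2, 1]) = {(0, 0), (1, 0), (1, 1), (2, 0)}"
  by (auto simp: cells_def less_Suc_eq)

lemma cells_22: "cells (of_parts [2, 2]) = {(0, 0), (0, 1), (1, 0), (1, 1)}"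
  by (auto simp: cells_def less_Suc_eq)

lemma cells_13: "cells (of_parts [1, 3]) = {(0, 0), (1, 0), (1, 1), (1, 2)}"
  by (auto simp: cells_def less_Suc_eq)

definition filling :: "composition \<Rightarrow> nat list list \<Rightarrow> nat \<times> nat \<Rightarrow> nat" where
  "filling \<alpha> rows = (\<lambda>(i, j)\<in>cells \<alpha>. rows ! i ! j)"

lemma single_add_single:
  "Poly_Mapping.single k a + (Poly_Mapping.single k b + m) = Poly_Mapping.single k (a + b) + m"
  by (simp add: single_add add.assoc)

lemma filling_22: "filling (of_parts [2, 2]) [[2, 2], [3, 1]] \<in> tableaux (of_parts [2, 2]) (of_parts [1, 2, 1])"
  unfolding tableaux_def SSRCT_def tableau_monomial_def filling_def cells_22
  by (auto simp: upt_rec numeral_eq_Suc single_add[symmetric] single_add_single add_ac)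

lemma filling_13: "filling (of_parts [1, 3]) [[1], [3, 2, 2]] \<in> tableaux (of_parts [1, 3]) (of_parts [1, 2, 1])"
  unfolding tableaux_def SSRCT_def tableau_monomial_def filling_def cells_13
  by (auto simp: upt_rec numeral_eq_Suc single_add[symmetric] single_add_single add_ac)

lemma filling_121:
  "filling (of_parts [1, 2, 1]) [[1], [3, 2], [4]] \<in> tableaux (of_parts [1, 2, 1]) (of_parts [1, 1, 1, 1])"
  unfolding tableaux_def SSRCT_def tableau_monomial_def filling_def cells_121
  by (auto simp: upt_rec numeral_eq_Suc single_add[symmetric] single_add_single add_ac)

text \<open>Content of length two forces at most two rows, and the weight bound discards \<open>(3,1)\<close>.\<close>

lemma shapes_of_content_22:
  assumes "M_coord (S \<alpha>) (of_parts [2, 2]) \<noteq> 0"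
  shows "\<alpha> = of_parts [4] \<or> \<alpha> = of_parts [2, 2] \<or> \<alpha> = of_parts [1, 3]"
proof -
  obtain \<tau> where t: "\<tau> \<in> tableaux \<alpha> (of_parts [2, 2])" using assms coord_S_neq_0_iff by blast
  have size: "csize \<alpha> = 4" using tableaux_csize[OF t] by (simp add: csize_of_parts)
  have "length (parts \<alpha>) \<le> 2" using tableaux_length_le[OF t] by simp
  then show ?thesis
  proof (rule length_le_2_cases[OF _ size])
    fix a b assume ab: "\<alpha> = of_parts [a, b]" "1 \<le> a" "1 \<le> b" "a + b = 4"
    then have "row_weight (of_parts [2, 2]) \<le> row_weight \<alpha>"
      by (intro tableaux_row_weight_le[OF t]) simp
    then have "6 \<le> a + 2 * b" using ab by (simp add: row_weight_of_parts)
    then have "a = 2 \<and> b = 2 \<or> a = 1 \<and> b = 3" using ab by linarith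
    then show ?thesis using ab by auto
  qed auto
qed

lemma content_22_imp_content_121:
  assumes "M_coord (S \<alpha>) (of_parts [2, 2]) \<noteq> 0"
  shows "M_coord (S \<alpha>) (of_parts [1, 2, 1]) \<noteq> 0"
proof -
  have "M_coord (S (of_parts [4])) (of_parts [1, 2, 1]) = 1"
    by (rule coord_S_row) (simp_all add: csize_of_parts)
  moreover have "M_coord (S (of_parts [2, 2])) (of_parts [1, 2, 1]) \<noteq> 0"
    "M_coord (S (of_parts [1, 3])) (of_parts [1, 2, 1]) \<noteq> 0"
    unfolding coord_S_neq_0_iff using filling_22 filling_13 by blast+
  ultimately show ?thesis using shapes_of_content_22[OF assms] by (metis zero_neq_one)
qed

text \<open>Four contents are settled by length, weight, the bound on the number of entries 1, and
  unitriangularity.  For standard fillings the shape imposes a total order on its cells: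
  \<open>\<tau> (0,0) < \<tau> (1,1) < \<tau> (1,0) < \<tau> (2,0)\<close>.\<close>

lemma coords_S_121:
  "M_coord (S (of_parts [1, 2, 1])) (of_parts [2, 2]) = 0"
  "M_coord (S (of_parts [1, 2, 1])) (of_parts [2, 1, 1]) = 0"
  "M_coord (S (of_parts [1, 2, 1])) (of_parts [1, 1, 2]) = 0"
  "M_coord (S (of_parts [1, 2, 1])) (of_parts [1, 2, 1]) = 1"
  "M_coord (S (of_parts [1, 2, 1])) (of_parts [1, 1, 1, 1]) = 1"
proof -
  let ?\<alpha> = "of_parts [1, 2, 1]"
  have "tableaux ?\<alpha> (of_parts [2, 2]) = {}"
    using tableaux_length_le[of _ ?\<alpha> "of_parts [2, 2]"] by fastforce
  then show "M_coord (S ?\<alpha>) (of_parts [2, 2]) = 0" by (simp add: coord_S)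
  have "tableaux ?\<alpha> (of_parts [2, 1, 1]) = {}"
    using tableaux_short_first_row[of _ ?\<alpha> "of_parts [2, 1, 1]" 2 "[1]"]
    by (fastforce simp: csize_of_parts)
  then show "M_coord (S ?\<alpha>) (of_parts [2, 1, 1]) = 0" by (simp add: coord_S)
  have "tableaux ?\<alpha> (of_parts [1, 1, 2]) = {}"
    using tableaux_row_weight_le[of _ ?\<alpha> "of_parts [1, 1, 2]"]
    by (fastforce simp: row_weight_of_parts numeral_3_eq_3)
  then show "M_coord (S ?\<alpha>) (of_parts [1, 1, 2]) = 0" by (simp add: coord_S)
  show "M_coord (S ?\<alpha>) ?\<alpha> = 1" by (rule coord_S_self)
  have "tableaux ?\<alpha> (of_parts [1, 1, 1, 1]) = {filling ?\<alpha> [[1], [3, 2], [4]]}"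
  proof (intro equalityI subsetI)
    fix \<tau> assume t: "\<tau> \<in> tableaux ?\<alpha> (of_parts [1, 1, 1, 1])"
    note S = tableaux_SSRCT[OF t]
    have c: "(0, 0) \<in> cells ?\<alpha>" "(1, 0) \<in> cells ?\<alpha>" "(1, 1) \<in> cells ?\<alpha>" "(2, 0) \<in> cells ?\<alpha>"
      "(0, 1) \<notin> cells ?\<alpha>" unfolding cells_121 by auto
    have column: "\<tau> (1, 0) < \<tau> (2, 0)"
      using SSRCT_first_column[OF S, of 1 2] by simp
    have row: "\<tau> (1, 1) \<le> \<tau> (1, 0)" using SSRCT_row_le_first[OF S] c by simp
    have triple: "\<tau> (0, 0) < \<tau> (1, 1)"
      using SSRCT_triple[OF S, of 0 1 0] c by simp
    have distinct: "\<tau> (1, 1) \<noteq> \<tau> (1, 0)"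
    proof
      assume eq: "\<tau> (1, 1) = \<tau> (1, 0)"
      let ?v = "\<tau> (1, 0) - 1"
      have v: "\<tau> (1, 0) = Suc ?v" "?v < 4" using tableaux_bounds[OF t c(2)] by simp_all
      have "card {(1 :: nat, 0 :: nat), (1, 1)} \<le> card {c \<in> cells ?\<alpha>. \<tau> c = Suc ?v}"
        using c eq v finite_cells by (intro card_mono) auto
      moreover have "card {c \<in> cells ?\<alpha>. \<tau> c = Suc ?v} = [1, 1, 1, 1] ! ?v"
        using tableaux_count[OF t, of ?v] v by simp
      moreover have "[1, 1, 1, 1] ! ?v = (1 :: nat)"
        using v(2) by (auto simp: less_Suc_eq numeral_eq_Suc)
      ultimately show False by simp
    qed
    have "\<tau> (2, 0) \<le> 4" "1 \<le> \<tau> (0, 0)" using tableaux_bounds[OF t] c by force+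
    then have vals: "\<tau> (0, 0) = 1 \<and> \<tau> (1, 1) = 2 \<and> \<tau> (1, 0) = 3 \<and> \<tau> (2, 0) = 4"
      using column row triple distinct by linarith
    have "\<tau> = filling ?\<alpha> [[1], [3, 2], [4]]"
      using SSRCT_PiE[OF S] vals unfolding filling_def cells_121
      by (intro extensionalityI[of _ "{(0, 0), (1, 0), (1, 1), (2, 0)}"]) (auto simp: PiE_def)
    then show "\<tau> \<in> {filling ?\<alpha> [[1], [3, 2], [4]]}" by simp
  qed (use filling_121 in auto)
  then show "M_coord (S ?\<alpha>) (of_parts [1, 1, 1, 1]) = 1" by (simp add: coord_S)
qed

section \<open>Automorphisms permuting the basis\<close>

lemma QSym_graded_iff: "f \<in> QSym_graded n \<longleftrightarrow> (\<forall>\<beta>. M_coord f \<beta> \<noteq> 0 \<longrightarrow> csize \<beta> = n)"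
proof
  assume f: "f \<in> QSym_graded n"
  show "\<forall>\<beta>. M_coord f \<beta> \<noteq> 0 \<longrightarrow> csize \<beta> = n"
  proof (intro allI impI, rule ccontr)
    fix \<beta> assume nz: "M_coord f \<beta> \<noteq> 0" and size: "csize \<beta> \<noteq> n"
    have zero: "rat_linear (\<lambda>_. 0)" by unfold_locales (auto simp: algebra_simps)
    have "M_coord f \<beta> = 0"
      by (rule functional_eq_on_span[OF linear_coord zero _ f[unfolded QSym_graded_def]])
         (use size in \<open>auto simp: M_coord_M\<close>)
    with nz show False by simp
  qed
next
  assume "\<forall>\<beta>. M_coord f \<beta> \<noteq> 0 \<longrightarrow> csize \<beta> = n"
  then have "(\<Sum>\<alpha> | M_coord f \<alpha> \<noteq> 0. scaleQ (M_coord f \<alpha>) (M \<alpha>)) \<in> QSym_graded n"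
    unfolding QSym_graded_def
    by (intro qsym.span_sum qsym.span_scale qsym.span_base) auto
  then show "f \<in> QSym_graded n" using M_expansion by metis
qed

lemma linear_coord_comp:
  "hopf_endomorphism \<phi> \<Longrightarrow> rat_linear (coord \<beta> \<circ> \<phi>)"
  unfolding hopf_endomorphism_def by (blast intro: Vector_Spaces.linear_compose linear_coord)

lemma eq_id_if_coords_fixed:
  assumes "\<And>\<beta>. coord \<beta> \<circ> \<phi> = coord \<beta>"
  shows "\<phi> = id"
proof
  fix f
  have "M_coord (\<phi> f) = M_coord f"
    using fun_cong[OF assms] by (intro ext) simp
  then have "(\<Sum>\<alpha> | M_coord (\<phi> f) \<alpha> \<noteq> 0. scaleQ (M_coord (\<phi> f) \<alpha>) (M \<alpha>))
      = (\<Sum>\<alpha> | M_coord f \<alpha> \<noteq> 0. scaleQ (M_coord f \<alpha>) (M \<alpha>))" by simp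
  then show "\<phi> f = id f" unfolding M_expansion[symmetric] by simp
qed

text \<open>On the spanning set, \<open>coord (n)\<close> is the indicator of \<open>S (n)\<close>, and an injective map
  that permutes the set and fixes \<open>S (n)\<close> moves nothing else onto it.\<close>

lemma row_coord_fixed:
  assumes \<phi>: "hopf_endomorphism \<phi>" and inj: "inj \<phi>"
    and perm: "\<And>\<alpha>. \<exists>\<beta>. \<phi> (S \<alpha>) = S \<beta>"
    and n: "1 \<le> n" and fixed: "\<phi> (S (of_parts [n])) = S (of_parts [n])"
  shows "coord (of_parts [n]) \<circ> \<phi> = coord (of_parts [n])"
proof (rule functional_eq_if_eq_on_S[OF linear_coord_comp[OF \<phi>] linear_coord])
  fix \<alpha>
  obtain \<beta> where \<beta>: "\<phi> (S \<alpha>) = S \<beta>" using perm by blast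
  have "M_coord (S \<beta>) (of_parts [n]) = M_coord (S \<alpha>) (of_parts [n])"
  proof (cases "\<beta> = of_parts [n]")
    case True
    then have "\<phi> (S \<alpha>) = \<phi> (S (of_parts [n]))" using \<beta> fixed by simp
    then have "S \<alpha> = S (of_parts [n])" using inj by (simp add: inj_eq)
    then show ?thesis using True by simp
  next
    case False
    then have "\<alpha> \<noteq> of_parts [n]" using \<beta> fixed coord_S_row_content[OF n] by (metis zero_neq_one)
    then show ?thesis using False by (simp add: coord_S_row_content[OF n])
  qed
  then show "(coord (of_parts [n]) \<circ> \<phi>) (S \<alpha>) = coord (of_parts [n]) (S \<alpha>)" using \<beta> by simp
qed

text \<open>The exchange is compatible with all structure up to degree 3, so the obstruction has to be
  sought in degree 4; the shape \<open>(1,2,1)\<close> provides it.\<close>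

lemma no_swap_in_degree_2:
  assumes \<phi>: "hopf_endomorphism \<phi>" and inj: "inj \<phi>"
    and perm: "\<And>\<alpha>. \<exists>\<beta>. \<phi> (S \<alpha>) = S \<beta>"
    and e1: "coord (of_parts [1]) \<circ> \<phi> = coord (of_parts [1])"
  shows "\<phi> (S (of_parts [2])) \<noteq> S (of_parts [1, 1])"
proof
  assume swap: "\<phi> (S (of_parts [2])) = S (of_parts [1, 1])"
  have ne: "of_parts [2] \<noteq> of_parts [1, 1]"
  proof
    assume "of_parts [2] = of_parts [1, 1]"
    then have "parts (of_parts [2]) = parts (of_parts [1, 1])" by (rule arg_cong)
    then show False by simp
  qed
  have c11: "coord (of_parts [1, 1]) \<circ> \<phi> = coord (of_parts [1, 1])"
    by (rule coord_fixed_if_row_coords_fixed[OF \<phi>, of 1]) (use e1 in \<open>auto simp: le_Suc_eq\<close>)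
  \<comment> \<open>Both basis elements of degree 2 have coefficient 1 at \<open>M (1,1)\<close>, and \<open>\<phi>\<close> preserves it.\<close>
  have size: "csize \<beta> = 2" if "csize \<alpha> = 2" "\<phi> (S \<alpha>) = S \<beta>" for \<alpha> \<beta>
  proof -
    have "M_coord (S \<alpha>) (of_parts [1, 1]) = 1"
      using csize_2_cases[OF that(1)] coord_S_self coord_S_row[of 2 "of_parts [1, 1]"]
      by (auto simp: csize_of_parts)
    then have "M_coord (S \<beta>) (of_parts [1, 1]) \<noteq> 0"
      using fun_cong[OF c11, of "S \<alpha>"] that(2) by simp
    then show ?thesis using csize_if_coord_S[of \<beta> "of_parts [1, 1]"] by (simp add: csize_of_parts)
  qed
  have swap': "\<phi> (S (of_parts [1, 1])) = S (of_parts [2])"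
  proof -
    obtain \<beta> where \<beta>: "\<phi> (S (of_parts [1, 1])) = S \<beta>" using perm by blast
    have "\<beta> \<noteq> of_parts [1, 1]"
    proof
      assume "\<beta> = of_parts [1, 1]"
      then have "S (of_parts [1, 1]) = S (of_parts [2])" using \<beta> swap inj by (metis inj_eq)
      then show False
        using ne coord_S_row_content[of 2 "of_parts [1, 1]"] coord_S_self[of "of_parts [2]"] by simp
    qed
    then show ?thesis using size[OF _ \<beta>] csize_2_cases \<beta> by (auto simp: csize_of_parts)
  qed
  have c2: "coord (of_parts [2]) \<circ> \<phi> = (\<lambda>f. coord (of_parts [1, 1]) f - coord (of_parts [2]) f)"
  proof (rule functional_eq_if_eq_on_S[OF linear_coord_comp[OF \<phi>]])
    show "rat_linear (\<lambda>f. coord (of_parts [1, 1]) f - coord (of_parts [2]) f)"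
      by unfold_locales (auto simp: M_coord_add M_coord_scale algebra_simps)
    fix \<alpha>
    obtain \<beta> where \<beta>: "\<phi> (S \<alpha>) = S \<beta>" using perm by blast
    consider "\<alpha> = of_parts [2]" | "\<alpha> = of_parts [1, 1]" | "csize \<alpha> \<noteq> 2" using csize_2_cases by blast
    then have "M_coord (\<phi> (S \<alpha>)) (of_parts [2])
        = M_coord (S \<alpha>) (of_parts [1, 1]) - M_coord (S \<alpha>) (of_parts [2])"
    proof cases
      case 1
      then show ?thesis
        using swap ne coord_S_row[of 2 "of_parts [1, 1]"]
        by (simp add: coord_S_row_content csize_of_parts)
    next
      case 2
      then show ?thesis using swap' ne
        by (simp add: coord_S_row_content coord_S_self del: One_nat_def)
    next
      case 3
      have "\<beta> \<noteq> of_parts [2]"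
      proof
        assume "\<beta> = of_parts [2]"
        then have "S \<alpha> = S (of_parts [1, 1])" using \<beta> swap' inj by (metis inj_eq)
        then have "M_coord (S \<alpha>) (of_parts [1, 1]) \<noteq> 0" by (simp add: coord_S_self)
        then show False using 3 csize_if_coord_S[of \<alpha> "of_parts [1, 1]"] by (simp add: csize_of_parts)
      qed
      moreover have "M_coord (S \<alpha>) (of_parts [2]) = 0" "M_coord (S \<alpha>) (of_parts [1, 1]) = 0"
        using 3 csize_if_coord_S[of \<alpha> "of_parts [1, 1]"] csize_if_coord_S[of \<alpha> "of_parts [2]"]
        by (auto simp: csize_of_parts)
      ultimately show ?thesis using \<beta> by (simp add: coord_S_row_content)
    qed
    then show "(coord (of_parts [2]) \<circ> \<phi>) (S \<alpha>)
        = coord (of_parts [1, 1]) (S \<alpha>) - coord (of_parts [2]) (S \<alpha>)"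
      by simp
  qed
  \<comment> \<open>The square \<open>(coord (1,1) - coord (2)) \<star> (coord (1,1) - coord (2))\<close>, expanded.\<close>
  have c22: "coord (of_parts [2, 2]) \<circ> \<phi> =
      (\<lambda>f. coord (of_parts [1, 1, 1, 1]) f - coord (of_parts [1, 1, 2]) f
      - (coord (of_parts [2, 1, 1]) f - coord (of_parts [2, 2]) f))"
    using coord_concat_hopf_endomorphism[OF \<phi>, of "of_parts [2]" "of_parts [2]"]
    by (simp add: c2 convolution_diff_left convolution_diff_right convolution_coord concat_of_parts)
  have c121: "coord (of_parts [1, 2, 1]) \<circ> \<phi> =
      (\<lambda>f. coord (of_parts [1, 1, 1, 1]) f - coord (of_parts [1, 2, 1]) f)"
    using coord_concat_hopf_endomorphism[OF \<phi>, of "of_parts [1, 2]" "of_parts [1]"]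
      coord_concat_hopf_endomorphism[OF \<phi>, of "of_parts [1]" "of_parts [2]"]
    by (simp add: c2 e1[unfolded One_nat_def] convolution_diff_left convolution_diff_right
        convolution_coord concat_of_parts)
  obtain \<beta> where \<beta>: "\<phi> (S (of_parts [1, 2, 1])) = S \<beta>" using perm by blast
  have "M_coord (S \<beta>) (of_parts [2, 2]) = 1"
    using fun_cong[OF c22, of "S (of_parts [1, 2, 1])"] \<beta> coords_S_121 by simp
  moreover have "M_coord (S \<beta>) (of_parts [1, 2, 1]) = 0"
    using fun_cong[OF c121, of "S (of_parts [1, 2, 1])"] \<beta> coords_S_121 by simp
  ultimately show False using content_22_imp_content_121[of \<beta>] by simp
qed

theorem theorem6p7:
  fixes \<phi> :: "qsym \<Rightarrow> qsym"
  assumes "hopf_automorphism \<phi>"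
    and "graded_map \<phi>"
    and "\<phi> ` {S \<alpha> |\<alpha>. True} = {S \<alpha> |\<alpha>. True}"
  shows "\<phi> = id"
proof -
  have \<phi>: "hopf_endomorphism \<phi>" and inj: "inj \<phi>"
    using assms(1) by (auto simp: hopf_automorphism_def bij_is_inj)
  have perm: "\<exists>\<beta>. \<phi> (S \<alpha>) = S \<beta>" for \<alpha>
  proof -
    have "\<phi> (S \<alpha>) \<in> \<phi> ` {S \<alpha> |\<alpha>. True}" by (rule imageI) blast
    then show ?thesis unfolding assms(3) by blast
  qed
  note row_coord = row_coord_fixed[OF \<phi> inj perm]
  have rows: "\<phi> (S (of_parts [n])) = S (of_parts [n])" if "1 \<le> n" for n
    using that
  proof (induction n rule: less_induct)
    case (less n)
    obtain \<alpha> where \<alpha>: "\<phi> (S (of_parts [n])) = S \<alpha>" using perm by blast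
    have lower: "M_coord (S \<alpha>) \<beta> = M_coord (S (of_parts [n])) \<beta>"
      if "\<forall>k\<in>set (parts \<beta>). k \<le> n - 1" for \<beta>
    proof -
      have "coord \<beta> \<circ> \<phi> = coord \<beta>"
        by (rule coord_fixed_if_row_coords_fixed[OF \<phi> _ that])
           (rule row_coord, use less in auto)
      from fun_cong[OF this, of "S (of_parts [n])"] show ?thesis using \<alpha> by simp
    qed
    consider "n = 1" | "n = 2" | "3 \<le> n" using less.prems by linarith
    then have "\<alpha> = of_parts [n]"
    proof cases
      case 1
      have "S (of_parts [n]) \<in> QSym_graded n"
        unfolding QSym_graded_iff using csize_if_coord_S less.prems by (auto simp: csize_of_parts)
      then have "\<phi> (S (of_parts [n])) \<in> QSym_graded n"
        using assms(2) unfolding graded_map_def by blast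
      then have "S \<alpha> \<in> QSym_graded n" unfolding \<alpha> .
      then have "csize \<alpha> = n" unfolding QSym_graded_iff using coord_S_self by (metis zero_neq_one)
      then show ?thesis
        using length_le_csize[of \<alpha>] 1 by (intro length_le_1_imp_row) auto
    next
      case 2
      have "M_coord (S \<alpha>) (of_parts [1, 1]) = 1"
        using lower[of "of_parts [1, 1]"] 2 coord_S_row[of 2 "of_parts [1, 1]"]
        by (simp add: csize_of_parts)
      then have "csize \<alpha> = 2" using csize_if_coord_S[of \<alpha> "of_parts [1, 1]"]
        by (simp add: csize_of_parts)
      moreover have "\<alpha> \<noteq> of_parts [1, 1]"
        using no_swap_in_degree_2[OF \<phi> inj perm row_coord[OF _ less.IH]] 2 \<alpha> by auto
      ultimately show ?thesis using csize_2_cases 2 by auto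
    next
      case 3
      have "M_coord (S \<alpha>) (of_parts [1, n - 1]) = 1" "M_coord (S \<alpha>) (of_parts [n - 1, 1]) = 1"
        using 3 by (subst lower; simp add: coord_S_row csize_of_parts)+
      then show ?thesis using only_row_has_both_hooks[OF 3] by simp
    qed
    then show ?case using \<alpha> by simp
  qed
  then have "coord (of_parts [n]) \<circ> \<phi> = coord (of_parts [n])" if "1 \<le> n" for n
    using row_coord that by blast
  then have "coord \<beta> \<circ> \<phi> = coord \<beta>" for \<beta>
    by (rule coord_fixed_if_row_coords_fixed[OF \<phi>, of "csize \<beta>"])
       (auto simp: csize_def member_le_sum_list)
  then show ?thesis by (rule eq_id_if_coords_fixed)
qed

end
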